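(* Let $k\ge1$. For all $t_1,t_2\in\mathrm{SOP}[\frac1{2^{k+1}}]$, $[\![t_1]\!]=[\![t_2]\!]$ if and only if $t_1\sim_{\mathrm{TH'}}t_2$.
   Context: An SOP morphism $t:n\to m$ is a formal expression $t=s\sum_{\vec y\in V^k}e^{2i\pi P(\vec y)}|\vec O(\vec y)\rangle\langle\vec I(\vec y)|$ where $s\in\mathbb R$, $\vec y$ are distinct boolean summation variables, $P\in\mathbb R[\vec y]/(y_j^2-y_j)$, $\vec O\in\mathbb F_2[\vec y]^m$, $\vec I\in\mathbb F_2[\vec y]^n$; morphisms are identified up to renaming variables and phase polynomials modulo integer-coefficient polynomials. Interpretation: $[\![t]\!]=s\sum_{\vec y\in\{0,1\}^k}e^{2i\pi P(\vec y)}|\vec O(\vec y)\rangle\langle\vec I(\vec y)|$. $\mathrm{SOP}[\frac1{2^n}]$ is the set of morphisms $\frac1{\sqrt2^{\,p}}\sum_{\vec y}e^{2i\pi\frac{P}{2^n}}|\vec O\rangle\langle\vec I|$ with $p\in\mathbb Z$ and $P$ with integer coefficients. For $Q\in\mathbb F_2[\vec y]$, $\widehat Q$ is defined by $\widehat{Q_1Q_2}=\widehat{Q_1}\widehat{Q_2}$, $\widehat{Q_1\oplus Q_2}=\widehat{Q_1}+\widehat{Q_2}-2\widehat{Q_1}\widehat{Q_2}$, $\widehat{y_j}=y_j$, $\widehat0=0,\widehat1=1$. Rewriting: $\mathrm{Var}(\cdot)$ is the set of variables in a collection of polynomials; $t[y\leftarrow Q]$ substitutes $Q$ for $y$ in $\vec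 O,\vec I$ and $\widehat Q$ in $P$. $\to_{\mathrm{TH'}}$ consists of the rules (applied to whole morphisms, scalar $s$ carried along unless stated): (Elim) $s\sum_{\vec y}e^{2i\pi P}|\vec O\rangle\langle\vec I|\to 2s\sum_{\vec y\setminus\{y_0\}}e^{2i\pi P}|\vec O\rangle\langle\vec I|$ if $y_0\notin\mathrm{Var}(P,\vec O,\vec I)$; (HHgen) $t=s\sum_{\vec y}e^{2i\pi(\frac{y_0}{2}(y_i\widehat Q+\widehat{Q'}+1)+R)}|\vec O\rangle\langle\vec I|\to t[y_i\leftarrow1\oplus Q']$ with $y_i$ removed from the summation, provided $y_0\ne y_i$, $QQ'=Q'$, $y_0\notin\mathrm{Var}(Q,Q',R,\vec O,\vec I)$, $y_i\notin\mathrm{Var}(Q,Q')$; (ket) if $O_i=y_0\oplus O_i'$, $O_i'\ne0$, $y_0\notin\mathrm{Var}(O_1,\dots,O_{i-1},O_i')$ then $t\to t[y_0\leftarrow O_i]$; (bra) if $I_i=y_0\oplus I_i'$, $I_i'\ne0$, $y_0\notin\mathrm{Var}(\vec O,I_1,\dots,I_{i-1},I_i')$ then $t\to t[y_0\leftarrow I_i]$; (Z) $s\sum_{\vec y}e^{2i\pi(\frac{y_0}{2}+R)}|\vec O\rangle\langle\vec I|\to\sum_{y_0}e^{2i\pi\frac{y_0}2}|0\cdots0\rangle\langle0\cdots0|$ if $y_0\notin\mathrm{Var}(R,\vec O,\vec I)$ and ($R\ne0$ or $\vec O,\vec I$ not all zero); and ($\sqrt2$) $s\sum_{\vec y}e^{2i\pi(\frac18+\frac34y_0+R)}|\vec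 O\rangle\langle\vec I|\to\sqrt2\,s\sum_{\vec y\setminus\{y_0\}}e^{2i\pi R}|\vec O\rangle\langle\vec I|$ if $y_0\notin\mathrm{Var}(R,\vec O,\vec I)$. $\sim_{\mathrm{TH'}}$ is the equivalence relation generated by $\to_{\mathrm{TH'}}$. *)

theory Defs
  imports
    Complex_Main
    "HOL-Library.FSet"
    "HOL-Library.FuncSet"
    "HOL-Library.Poly_Mapping"
    "HOL-Library.Z2"
begin

section \<open>Boolean polynomials\<close>

text \<open>
  Variables are natural numbers. Modulo $y_j^2 = y_j$ a monomial is the finite set of
  the variables occurring in it, and the product of monomials is union. Hence the monoid algebra
  \<open>mono \<Rightarrow>\<^sub>0 'a\<close>, with the convolution product of the library, is the
  polynomial ring $R[y_0, y_1, \dots]/(y_j^2 - y_j)$ over the coefficient ring \<open>'a\<close>.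
\<close>

datatype mono = Mono (mvars: "nat fset")

instantiation mono :: comm_monoid_add
begin

definition zero_mono :: mono where "0 = Mono {||}"

definition plus_mono :: "mono \<Rightarrow> mono \<Rightarrow> mono"
  where "M + N = Mono (mvars M |\<union>| mvars N)"

instance
  by standard (auto simp: zero_mono_def plus_mono_def)

end

type_synonym 'a bpoly = "mono \<Rightarrow>\<^sub>0 'a"

definition Cst :: "'a::zero \<Rightarrow> 'a bpoly"
  where "Cst c = Poly_Mapping.single 0 c"

definition X :: "nat \<Rightarrow> 'a::zero_neq_one bpoly"
  where "X j = Poly_Mapping.single (Mono {|j|}) 1"

definition pvars :: "'a::zero bpoly \<Rightarrow> nat set"
  where "pvars p = (\<Union>M\<in>Poly_Mapping.keys p. fset (mvars M))"

definition Var :: "'a::zero bpoly set \<Rightarrow> nat set"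
  where "Var S = (\<Union>p\<in>S. pvars p)"

definition peval :: "(nat \<Rightarrow> bool) \<Rightarrow> 'a::comm_ring_1 bpoly \<Rightarrow> 'a"
  where "peval v p =
    (\<Sum>M\<in>Poly_Mapping.keys p. Poly_Mapping.lookup p M * (\<Prod>j\<in>fset (mvars M). of_bool (v j)))"

definition psubst :: "(nat \<Rightarrow> 'a bpoly) \<Rightarrow> 'a::comm_ring_1 bpoly \<Rightarrow> 'a bpoly"
  where "psubst \<sigma> p =
    (\<Sum>M\<in>Poly_Mapping.keys p. Cst (Poly_Mapping.lookup p M) * (\<Prod>j\<in>fset (mvars M). \<sigma> j))"

definition int_coeffs :: "real bpoly \<Rightarrow> bool"
  where "int_coeffs p \<longleftrightarrow> (\<forall>M. Poly_Mapping.lookup p M \<in> \<int>)"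


section \<open>The lifting of polynomials over the two-element field to real polynomials\<close>

text \<open>The map $Q \mapsto \widehat Q$ is introduced by its defining equations; lemma
  \<open>ex1_is_lift\<close> shows that they determine it.\<close>

definition is_lift :: "(bit bpoly \<Rightarrow> real bpoly) \<Rightarrow> bool"
  where "is_lift h \<longleftrightarrow>
    (\<forall>Q1 Q2. h (Q1 * Q2) = h Q1 * h Q2) \<and>
    (\<forall>Q1 Q2. h (Q1 + Q2) = h Q1 + h Q2 - 2 * h Q1 * h Q2) \<and>
    (\<forall>j. h (X j) = X j) \<and> h 0 = 0 \<and> h 1 = 1"

definition lift :: "bit bpoly \<Rightarrow> real bpoly"
  where "lift = (THE h. is_lift h)"

lemma bpoly_bit_induct [case_names zero add]:
  fixes Q :: "bit bpoly"
  assumes "P 0" and "\<And>M Q. P Q \<Longrightarrow> P (Poly_Mapping.single M 1 + Q)"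
  shows "P Q"
proof (induction "card (Poly_Mapping.keys Q)" arbitrary: Q rule: less_induct)
  case less
  show ?case
  proof (cases "Q = 0")
    case True
    then show ?thesis using assms(1) by simp
  next
    case False
    then obtain M where M: "M \<in> Poly_Mapping.keys Q"
      by (metis keys_eq_empty ex_in_conv)
    define Q' where "Q' = Poly_Mapping.single M 1 + Q"
    have lk: "Poly_Mapping.lookup Q M = 1"
      using M by (simp add: in_keys_iff)
    have "Poly_Mapping.keys Q' = Poly_Mapping.keys Q - {M}"
      using lk by (auto simp: Q'_def in_keys_iff lookup_add lookup_single when_def split: if_splits)
    then have "card (Poly_Mapping.keys Q') < card (Poly_Mapping.keys Q)"
      using M by (metis finite_keys card_Diff1_less)
    then have "P Q'" by (rule less)
    then have "P (Poly_Mapping.single M 1 + Q')" by (rule assms(2))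
    moreover have "Poly_Mapping.single M (1::bit) + Poly_Mapping.single M 1 = 0"
      by (simp only: single_add[symmetric]) simp
    then have "Poly_Mapping.single M 1 + Q' = Q"
      by (simp only: Q'_def add.assoc[symmetric]) simp
    ultimately show ?thesis by simp
  qed
qed

lemma single_mono_eq_prod:
  "Poly_Mapping.single M (1::'a::comm_ring_1) = (\<Prod>j\<in>fset (mvars M). X j)"
proof -
  have "Poly_Mapping.single (Mono A) (1::'a) = (\<Prod>j\<in>fset A. X j)" for A
  proof (induction A)
    case empty
    show ?case by (simp flip: zero_mono_def)
  next
    case (insert x A)
    have "Poly_Mapping.single (Mono (finsert x A)) (1::'a) = X x * Poly_Mapping.single (Mono A) 1"
      by (simp add: X_def mult_single plus_mono_def)
    then show ?case using insert by simp
  qed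
  then show ?thesis by (cases M) simp
qed

lemma is_lift_single:
  assumes "is_lift h"
  shows "h (Poly_Mapping.single M 1) = Poly_Mapping.single M 1"
proof -
  have "h (\<Prod>j\<in>A. X j) = (\<Prod>j\<in>A. X j)" if "finite A" for A
    using that by induction (use assms in \<open>auto simp: is_lift_def\<close>)
  then show ?thesis by (simp add: single_mono_eq_prod)
qed

lemma ex1_is_lift: "\<exists>!h. is_lift h"
proof -
  define e where "e M = (Poly_Mapping.single M 1 :: real bpoly)" for M
  define g where "g Q = (\<Prod>M\<in>Poly_Mapping.keys Q. 1 - 2 * e M)" for Q :: "bit bpoly"
  define c where "c = (Cst (1/2) :: real bpoly)"
  define h where "h Q = c * (1 - g Q)" for Q
  have c2: "2 * c = 1"
  proof -
    have "2 * c = Poly_Mapping.single 0 2 * Poly_Mapping.single 0 (1/2)"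
      by (simp only: c_def Cst_def single_numeral)
    also have "\<dots> = 1" by (simp only: mult_single) simp
    finally show ?thesis .
  qed
  have ee: "e M * e M = e M" for M
    by (simp add: e_def mult_single plus_mono_def)
  have sq: "(1 - 2 * e M) * (1 - 2 * e M) = 1" for M
  proof -
    have "(1 - 2 * e M) * (1 - 2 * e M) = 1 - 4 * e M + 4 * (e M * e M)"
      by (simp add: algebra_simps)
    then show ?thesis by (simp add: ee)
  qed
  have g2h: "g Q = 1 - 2 * h Q" for Q
    using c2 by (simp add: h_def mult.assoc[symmetric])
  have g0: "g 0 = 1" by (simp add: g_def)
  have gsingle: "g (Poly_Mapping.single M 1) = 1 - 2 * e M" for M
    by (simp add: g_def)
  have gadd1: "g (Poly_Mapping.single M 1 + Q) = (1 - 2 * e M) * g Q" for M Q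
  proof (cases "M \<in> Poly_Mapping.keys Q")
    case True
    then have "Poly_Mapping.keys (Poly_Mapping.single M 1 + Q) = Poly_Mapping.keys Q - {M}"
      by (auto simp: in_keys_iff lookup_add lookup_single when_def split: if_splits)
    moreover have "g Q = (1 - 2 * e M) * (\<Prod>M\<in>Poly_Mapping.keys Q - {M}. 1 - 2 * e M)"
      unfolding g_def using True by (simp add: prod.remove)
    ultimately show ?thesis
      by (simp add: g_def mult.assoc[symmetric] sq)
  next
    case False
    then have "Poly_Mapping.keys (Poly_Mapping.single M 1 + Q) = insert M (Poly_Mapping.keys Q)"
      by (auto simp: in_keys_iff lookup_add lookup_single when_def split: if_splits)
    then show ?thesis using False by (simp add: g_def)
  qed
  have gadd: "g (Q1 + Q2) = g Q1 * g Q2" for Q1 Q2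
    by (induction Q1 rule: bpoly_bit_induct) (simp_all add: g0 gadd1 add.assoc mult.assoc)
  have hadd: "h (Q1 + Q2) = h Q1 + h Q2 - 2 * h Q1 * h Q2" for Q1 Q2
  proof -
    have "h (Q1 + Q2) = c * (1 - (1 - 2 * h Q1) * (1 - 2 * h Q2))"
      by (simp only: h_def[of "Q1 + Q2"] gadd) (simp only: g2h)
    also have "\<dots> = (2 * c) * (h Q1 + h Q2 - 2 * h Q1 * h Q2)"
      by (simp add: algebra_simps)
    finally show ?thesis by (simp add: c2)
  qed
  have hsingle: "h (Poly_Mapping.single M 1) = e M" for M
  proof -
    have "h (Poly_Mapping.single M 1) = (2 * c) * e M"
      by (simp add: h_def gsingle algebra_simps)
    then show ?thesis by (simp add: c2)
  qed
  have h0: "h 0 = 0" by (simp add: h_def g0)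
  have idem: "h Q * h Q = h Q" for Q
  proof (induction Q rule: bpoly_bit_induct)
    case zero
    show ?case by (simp add: h0)
  next
    case (add M Q)
    have "(e M + h Q - 2 * e M * h Q) * (e M + h Q - 2 * e M * h Q) =
      e M * e M + h Q * h Q + 2 * e M * h Q - 4 * (e M * e M) * h Q - 4 * e M * (h Q * h Q)
      + 4 * (e M * e M) * (h Q * h Q)"
      by (simp add: algebra_simps)
    then show ?case by (simp add: hadd hsingle ee add algebra_simps)
  qed
  have hmult1: "h (Poly_Mapping.single M 1 * Q) = e M * h Q" for M Q
  proof (induction Q rule: bpoly_bit_induct)
    case zero
    show ?case by (simp add: h0)
  next
    case (add N Q)
    have "h (Poly_Mapping.single M 1 * (Poly_Mapping.single N 1 + Q)) =
      h (Poly_Mapping.single (M + N) 1 + Poly_Mapping.single M 1 * Q)"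
      by (simp add: distrib_left mult_single)
    also have "\<dots> = e (M + N) + e M * h Q - 2 * e (M + N) * (e M * h Q)"
      by (simp add: hadd hsingle add)
    also have "e (M + N) = e M * e N"
      by (simp add: e_def mult_single)
    also have "e M * e N + e M * h Q - 2 * (e M * e N) * (e M * h Q) =
      e M * e N + e M * h Q - 2 * (e M * e M) * e N * h Q"
      by (simp add: algebra_simps)
    also have "\<dots> = e M * h (Poly_Mapping.single N 1 + Q)"
      by (simp add: ee hadd hsingle algebra_simps)
    finally show ?case .
  qed
  have hmult: "h (Q1 * Q2) = h Q1 * h Q2" for Q1 Q2
  proof (induction Q1 rule: bpoly_bit_induct)
    case zero
    show ?case by (simp add: h0)
  next
    case (add M Q)
    have "h ((Poly_Mapping.single M 1 + Q) * Q2) =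
      e M * h Q2 + h Q * h Q2 - 2 * (e M * h Q2) * (h Q * h Q2)"
      by (simp add: distrib_right hadd hmult1 add)
    also have "\<dots> = e M * h Q2 + h Q * h Q2 - 2 * e M * h Q * (h Q2 * h Q2)"
      by (simp add: algebra_simps)
    also have "\<dots> = h (Poly_Mapping.single M 1 + Q) * h Q2"
      by (simp add: idem hadd hsingle algebra_simps)
    finally show ?case .
  qed
  have ex: "is_lift h"
    unfolding is_lift_def
    using hmult hadd h0 hsingle[of 0] hsingle[of "Mono {|j|}" for j]
    by (auto simp: X_def e_def)
  have "h1 = h2" if "is_lift h1" "is_lift h2" for h1 h2
  proof
    fix Q
    show "h1 Q = h2 Q"
    proof (induction Q rule: bpoly_bit_induct)
      case zero
      show ?case using that by (simp add: is_lift_def)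
    next
      case (add M Q)
      have step: "h' (Poly_Mapping.single M 1 + Q) =
        Poly_Mapping.single M 1 + h' Q - 2 * Poly_Mapping.single M 1 * h' Q" if "is_lift h'" for h'
        using that is_lift_single[OF that] by (simp add: is_lift_def)
      show ?case by (simp add: step[OF that(1)] step[OF that(2)] add)
    qed
  qed
  with ex show ?thesis by blast
qed

lemma is_lift_lift: "is_lift lift"
  unfolding lift_def by (rule theI'[OF ex1_is_lift])

lemma lift_mult: "lift (Q1 * Q2) = lift Q1 * lift Q2"
  and lift_add: "lift (Q1 + Q2) = lift Q1 + lift Q2 - 2 * lift Q1 * lift Q2"
  and lift_X [simp]: "lift (X j) = X j"
  and lift_0 [simp]: "lift 0 = 0"
  and lift_1 [simp]: "lift 1 = 1"
  using is_lift_lift by (simp_all add: is_lift_def)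


section \<open>Sums over paths\<close>

text \<open>
  \<open>SOP s V P Os Is\<close> stands for
  $s \sum_{\vec y \in \{0,1\}^V} e^{2 i \pi P} |\vec O\rangle\langle\vec I|$, where \<open>V\<close> is the set of
  summation variables. Values of this type are representatives; the identification of morphisms up
  to renaming and integer phases is the relation \<open>sop_ident\<close> below.
\<close>

datatype sop = SOP
  (scalar: real) (svars: "nat set") (phase: "real bpoly") (kets: "bit bpoly list")
  (bras: "bit bpoly list")

definition wf_sop :: "sop \<Rightarrow> bool"
  where "wf_sop t \<longleftrightarrow>
    finite (svars t) \<and> pvars (phase t) \<subseteq> svars t \<and>
    Var (set (kets t)) \<subseteq> svars t \<and> Var (set (bras t)) \<subseteq> svars t"

definition SOP_hom :: "nat \<Rightarrow> nat \<Rightarrow> sop set"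
  where "SOP_hom n m = {t. wf_sop t \<and> length (bras t) = n \<and> length (kets t) = m}"

definition SOP_dyadic :: "nat \<Rightarrow> nat \<Rightarrow> nat \<Rightarrow> sop set"
  where "SOP_dyadic d n m = {t \<in> SOP_hom n m.
    (\<exists>p::int. scalar t = 1 / (sqrt 2 powi p)) \<and>
    (\<exists>P. int_coeffs P \<and> phase t = Cst (1 / 2 ^ d) * P)}"

text \<open>Linear maps $\mathbb{C}^{2^n} \to \mathbb{C}^{2^m}$ are given by their matrices in the
  computational basis, indexed by bit strings: row \<open>x\<close>, column \<open>w\<close>.\<close>

definition ketbra :: "bit list \<Rightarrow> bit list \<Rightarrow> bit list \<Rightarrow> bit list \<Rightarrow> complex"
  where "ketbra a b x w = of_bool (x = a \<and> w = b)"

definition interp :: "sop \<Rightarrow> bit list \<Rightarrow> bit list \<Rightarrow> complex"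
  where "interp t x w = of_real (scalar t) *
    (\<Sum>v \<in> svars t \<rightarrow>\<^sub>E UNIV.
       exp (2 * \<i> * of_real pi * of_real (peval v (phase t))) *
       ketbra (map (peval v) (kets t)) (map (peval v) (bras t)) x w)"

definition sop_ident :: "sop \<Rightarrow> sop \<Rightarrow> bool"
  where "sop_ident t u \<longleftrightarrow> wf_sop t \<and> wf_sop u \<and>
    (\<exists>f. inj_on f (svars t) \<and> svars u = f ` svars t \<and>
      scalar u = scalar t \<and>
      int_coeffs (phase u - psubst (\<lambda>j. X (f j)) (phase t)) \<and>
      kets u = map (psubst (\<lambda>j. X (f j))) (kets t) \<and>
      bras u = map (psubst (\<lambda>j. X (f j))) (bras t))"


section \<open>The rewriting system\<close>

text \<open>The set of summation variables is left unchanged by \<open>sop_subst\<close>.\<close>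

definition sop_subst :: "nat \<Rightarrow> bit bpoly \<Rightarrow> sop \<Rightarrow> sop"
  where "sop_subst y Q t = SOP (scalar t) (svars t)
    (psubst (X(y := lift Q)) (phase t))
    (map (psubst (X(y := Q))) (kets t))
    (map (psubst (X(y := Q))) (bras t))"

definition remove_var :: "nat \<Rightarrow> sop \<Rightarrow> sop"
  where "remove_var y t = SOP (scalar t) (svars t - {y}) (phase t) (kets t) (bras t)"

text \<open>In rule \<open>Z\<close> the phase \<open>R\<close> is an element of a quotient by the integer polynomials,
  so $R \neq 0$ means that \<open>R\<close> has a non-integer coefficient.\<close>

inductive th_step :: "sop \<Rightarrow> sop \<Rightarrow> bool" where
  Elim:
    "\<lbrakk>t = SOP s V P Os Is; wf_sop t; y0 \<in> V; y0 \<notin> pvars P \<union> Var (set Os \<union> set Is)\<rbrakk>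
     \<Longrightarrow> th_step t (SOP (2 * s) (V - {y0}) P Os Is)"
| HHgen:
    "\<lbrakk>t = SOP s V (Cst (1/2) * X y0 * (X yi * lift Q + lift Q' + 1) + R) Os Is; wf_sop t;
      y0 \<in> V; yi \<in> V; Var {Q, Q'} \<subseteq> V; pvars R \<subseteq> V;
      y0 \<noteq> yi; Q * Q' = Q';
      y0 \<notin> Var {Q, Q'} \<union> pvars R \<union> Var (set Os \<union> set Is); yi \<notin> Var {Q, Q'}\<rbrakk>
     \<Longrightarrow> th_step t (remove_var yi (sop_subst yi (1 + Q') t))"
| ket:
    "\<lbrakk>t = SOP s V P Os Is; wf_sop t; y0 \<in> V; i < length Os; Os ! i = X y0 + O'; O' \<noteq> 0;
      y0 \<notin> Var (set (take i Os) \<union> {O'})\<rbrakk>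
     \<Longrightarrow> th_step t (sop_subst y0 (Os ! i) t)"
| bra:
    "\<lbrakk>t = SOP s V P Os Is; wf_sop t; y0 \<in> V; i < length Is; Is ! i = X y0 + I'; I' \<noteq> 0;
      y0 \<notin> Var (set Os \<union> set (take i Is) \<union> {I'})\<rbrakk>
     \<Longrightarrow> th_step t (sop_subst y0 (Is ! i) t)"
| Z:
    "\<lbrakk>t = SOP s V (Cst (1/2) * X y0 + R) Os Is; wf_sop t; y0 \<in> V;
      y0 \<notin> pvars R \<union> Var (set Os \<union> set Is);
      \<not> int_coeffs R \<or> (\<exists>p \<in> set Os \<union> set Is. p \<noteq> 0)\<rbrakk>
     \<Longrightarrow> th_step t (SOP 1 {y0} (Cst (1/2) * X y0)
            (replicate (length Os) 0) (replicate (length Is) 0))"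
| sqrt2:
    "\<lbrakk>t = SOP s V (Cst (1/8) + Cst (3/4) * X y0 + R) Os Is; wf_sop t; y0 \<in> V;
      y0 \<notin> pvars R \<union> Var (set Os \<union> set Is)\<rbrakk>
     \<Longrightarrow> th_step t (SOP (sqrt 2 * s) (V - {y0}) R Os Is)"

definition th_equiv :: "sop \<Rightarrow> sop \<Rightarrow> bool"  (infix \<open>\<sim>\<^sub>T\<^sub>H\<close> 50)
  where "th_equiv = equivclp (\<lambda>t u. sop_ident t u \<or> th_step t u)"

end

theory Submission
  imports Defs "HOL-Computational_Algebra.Polynomial"
begin

text \<open>
  Soundness is checked rule by rule. For completeness, only Elim, \<open>sqrt2\<close> and the instance
  \<open>Q = 1\<close> of HHgen are needed. HHgen followed by Elim says that a phase
  \<open>a/2 (b + q)\<close>, with \<open>a\<close> occurring nowhere else, substitutes \<open>q\<close> for \<open>b\<close>.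
  Read backwards, this makes all kets and bras distinct variables, so that a morphism is a family of sums of roots of unity
  $\sum_u \omega^{c(x,u)}$, indexed by the assignments \<open>x\<close> of these variables. By Elim and \<open>sqrt2\<close>
  two morphisms can be given the same scalar and the same internal variables \<open>u\<close>.

  Introducing a variable \<open>z = u_i + g\<close> and eliminating \<open>u_i = z + g\<close> instead of \<open>z\<close>
  changes the phase by the transvection $u_i \mapsto u_i + g$; such maps generate all permutations of the internal
  assignments over a fixed \<open>x\<close>. Moreover two paths with opposite phases can be given any other two
  opposite phases: after swapping in a dummy variable \<open>y\<close> their contribution is restricted by a
  factor $(-1)^y$, which expresses that the branch is zero. Since the powers
  $1, \omega, \dots, \omega^{2^K-1}$ of a root of unity of order $2^{K+1}$ are linearly independent over
  the rationals, equal sums have phase multisets that differ by opposite pairs only, and these two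
  moves suffice.
\<close>

section \<open>Evaluation of Boolean polynomials\<close>

text \<open>Phase polynomials may have any degree, so the control \<open>g\<close> of a transvection
  can be the indicator of a single assignment. This makes the calculus as fine as the table of
  phases itself: entries can be moved one at a time. The obstacle is that permutations never change
  the multiset of phases, while equal sums only force equal differences between the counts of w^j
  and -w^j. Once scalar and variables agree the number of paths is fixed, so an opposite pair cannot
  be deleted; it has to be overwritten by another opposite pair. A vanishing interpretation is no
  special case, as the scalars are nonzero. Derivations may leave the given fragment: adding a
  variable by the rule \<open>sqrt2\<close> brings in eighths, so the comparison takes place over
  the denominator 2^(k+4). Linear independence is obtained from total ramification: w - 1 behaves
  like a uniformizer above 2, and parity of integer coefficients replaces the irreducibility of the
  cyclotomic polynomial.\<close>

lemma prod_of_bool_eq: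
  "finite A \<Longrightarrow> (\<Prod>j\<in>A. of_bool (v j)) = (of_bool (\<forall>j\<in>A. v j) :: 'a::comm_semiring_1)"
  by (induction rule: finite_induct) auto

lemma peval_superset:
  fixes p :: "'a::comm_ring_1 bpoly"
  assumes "finite A" "Poly_Mapping.keys p \<subseteq> A"
  shows "peval v p = (\<Sum>M\<in>A. Poly_Mapping.lookup p M * of_bool (\<forall>j\<in>fset (mvars M). v j))"
proof -
  have "peval v p =
    (\<Sum>M\<in>Poly_Mapping.keys p. Poly_Mapping.lookup p M * of_bool (\<forall>j\<in>fset (mvars M). v j))"
    unfolding peval_def by (simp add: prod_of_bool_eq)
  also have "\<dots> = (\<Sum>M\<in>A. Poly_Mapping.lookup p M * of_bool (\<forall>j\<in>fset (mvars M). v j))"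
    using assms by (intro sum.mono_neutral_left) (auto simp: in_keys_iff)
  finally show ?thesis .
qed

lemma peval_add [simp]: "peval v (p + q) = peval v p + peval v (q :: 'a::comm_ring_1 bpoly)"
  using keys_add[of p q]
  by (simp add: peval_superset[of "Poly_Mapping.keys p \<union> Poly_Mapping.keys q"] lookup_add
      distrib_right sum.distrib)

lemma peval_0 [simp]: "peval v (0 :: 'a::comm_ring_1 bpoly) = 0"
  by (simp add: peval_def)

lemma peval_single [simp]:
  "peval v (Poly_Mapping.single M (c :: 'a::comm_ring_1)) = c * of_bool (\<forall>j\<in>fset (mvars M). v j)"
  by (subst peval_superset[of "{M}"]) auto

lemma peval_Cst [simp]: "peval v (Cst (c :: 'a::comm_ring_1)) = c"
  by (simp add: Cst_def zero_mono_def)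

lemma peval_1 [simp]: "peval v (1 :: 'a::comm_ring_1 bpoly) = 1"
  using peval_Cst[of v "1::'a"] by (simp only: Cst_def single_one)

lemma peval_X [simp]: "peval v (X j :: 'a::comm_ring_1 bpoly) = of_bool (v j)"
  by (simp add: X_def)

lemma peval_numeral [simp]: "peval v (numeral k :: 'a::comm_ring_1 bpoly) = numeral k"
  using peval_Cst[of v "numeral k :: 'a"] by (simp only: Cst_def single_numeral)

lemma peval_uminus [simp]: "peval v (- p) = - peval v (p :: 'a::comm_ring_1 bpoly)"
  using peval_add[of v "- p" p] by (simp add: eq_neg_iff_add_eq_0)

lemma peval_diff [simp]: "peval v (p - q) = peval v p - peval v (q :: 'a::comm_ring_1 bpoly)"
  using peval_add[of v p "- q"] by simp

lemma peval_sum [simp]: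
  "peval v (\<Sum>i\<in>A. f i) = (\<Sum>i\<in>A. peval v (f i :: 'a::comm_ring_1 bpoly))"
  by (induction A rule: infinite_finite_induct) auto

lemma bpoly_sum_single:
  "p = (\<Sum>M\<in>Poly_Mapping.keys p. Poly_Mapping.single M (Poly_Mapping.lookup p M))"
  for p :: "'a::comm_ring_1 bpoly"
  by (rule poly_mapping_eqI) (simp add: lookup_sum lookup_single when_def in_keys_iff)

lemma peval_mult [simp]: "peval v (p * q) = peval v p * peval v (q :: 'a::comm_ring_1 bpoly)"
proof -
  let ?s = "\<lambda>p :: 'a bpoly. (\<Sum>M\<in>Poly_Mapping.keys p. Poly_Mapping.single M (Poly_Mapping.lookup p M))"
  have *: "peval v (Poly_Mapping.single M c * Poly_Mapping.single N d) =
    peval v (Poly_Mapping.single M c) * peval v (Poly_Mapping.single N d)" for M N and c d :: 'a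
    by (auto simp: mult_single plus_mono_def)
  have "peval v (?s p * ?s q) = peval v (?s p) * peval v (?s q)"
    by (simp only: sum_product peval_sum *)
  then show ?thesis by (simp only: bpoly_sum_single[symmetric])
qed

lemma peval_prod [simp]:
  "peval v (\<Prod>i\<in>A. f i) = (\<Prod>i\<in>A. peval v (f i :: 'a::comm_ring_1 bpoly))"
  by (induction A rule: infinite_finite_induct) auto

lemma peval_psubst:
  fixes p :: "'a::comm_ring_1 bpoly"
  assumes "\<And>j. peval v (\<sigma> j) = of_bool (w j)"
  shows "peval v (psubst \<sigma> p) = peval w p"
  unfolding psubst_def by (simp add: assms) (simp add: peval_def)

lemma peval_cong:
  assumes "\<And>j. j \<in> pvars p \<Longrightarrow> v j = w j"
  shows "peval v p = peval w (p :: 'a::comm_ring_1 bpoly)"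
proof -
  have "(\<Prod>j\<in>fset (mvars M). of_bool (v j)) = (\<Prod>j\<in>fset (mvars M). of_bool (w j) :: 'a)"
    if "M \<in> Poly_Mapping.keys p" for M
    using that by (intro prod.cong) (use assms in \<open>auto simp: pvars_def\<close>)
  then show ?thesis unfolding peval_def by (intro sum.cong) simp_all
qed

lemma peval_upd [simp]: "y \<notin> pvars p \<Longrightarrow> peval (v(y := b)) p = peval v (p :: 'a::comm_ring_1 bpoly)"
  by (rule peval_cong) auto

text \<open>Moebius inversion on the lattice of the monomials above \<open>A\<close>.\<close>

lemma lookup_in_subgroup:
  fixes p :: "'a::comm_ring_1 bpoly"
  assumes G: "0 \<in> G" "\<And>a b. a \<in> G \<Longrightarrow> b \<in> G \<Longrightarrow> a - b \<in> G"
    and ev: "\<And>v. (\<And>j. j \<in> A \<Longrightarrow> v j) \<Longrightarrow> (\<Sum>M | M \<in> Poly_Mapping.keys p \<and> A \<subseteq> fset (mvars M).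
       Poly_Mapping.lookup p M * of_bool (\<forall>j\<in>fset (mvars M). v j)) \<in> G"
    and "A \<subseteq> fset (mvars M)"
  shows "Poly_Mapping.lookup p M \<in> G"
  using assms(4)
proof (induction "card (fset (mvars M))" arbitrary: M rule: less_induct)
  case less
  have Gadd: "a + b \<in> G" if "a \<in> G" "b \<in> G" for a b
    using G(2)[OF that(1) G(2)[OF G(1) that(2)]] by simp
  show ?case
  proof (cases "M \<in> Poly_Mapping.keys p")
    case False
    then show ?thesis using G by (simp add: in_keys_iff)
  next
    case True
    \<comment> \<open>The indicator of \<open>M\<close> kills every monomial not contained in
      \<open>M\<close>. Besides \<open>M\<close> only proper subsets survive, and these are covered
      by the induction hypothesis.\<close>
    let ?v = "\<lambda>j. j \<in> fset (mvars M)"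
    let ?S = "{M. M \<in> Poly_Mapping.keys p \<and> A \<subseteq> fset (mvars M)}"
    let ?f = "\<lambda>N. Poly_Mapping.lookup p N * of_bool (\<forall>j\<in>fset (mvars N). ?v j)"
    have "(\<Sum>N\<in>?S. ?f N) \<in> G" using less.prems by (intro ev) auto
    also have "(\<Sum>N\<in>?S. ?f N) = Poly_Mapping.lookup p M + (\<Sum>N\<in>?S - {M}. ?f N)"
      using True less.prems by (subst sum.remove[of _ M]) auto
    finally have sum: "Poly_Mapping.lookup p M + (\<Sum>N\<in>?S - {M}. ?f N) \<in> G" .
    have fG: "?f N \<in> G" if N: "N \<in> ?S - {M}" for N
    proof (cases "fset (mvars N) \<subseteq> fset (mvars M)")
      case True
      have "mvars N \<noteq> mvars M" using N by (auto intro: mono.expand)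
      with True have "fset (mvars N) \<subset> fset (mvars M)" by (auto simp: fset_inject)
      then have "card (fset (mvars N)) < card (fset (mvars M))" by (intro psubset_card_mono) auto
      then have "Poly_Mapping.lookup p N \<in> G" using N by (intro less.hyps) auto
      then show ?thesis using True by (auto simp: subset_iff)
    next
      case False
      then have "?f N = 0" by auto
      then show ?thesis using G by metis
    qed
    have sum_G: "sum g B \<in> G" if "\<And>N. N \<in> B \<Longrightarrow> g N \<in> G" for g and B :: "mono set"
      using that by (induction B rule: infinite_finite_induct) (auto intro: Gadd G(1))
    have "(\<Sum>N\<in>?S - {M}. ?f N) \<in> G" by (rule sum_G) (rule fG)
    from G(2)[OF sum this] show ?thesis by simp
  qed
qed

text \<open>The subgroup is a parameter because two instances are wanted: \<open>{0}\<close> shows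
  that a polynomial is determined by its values at Boolean points, and \<int> that integer values
  force integer coefficients.\<close>

lemma lookup_in_subgroup_of_peval:
  fixes p :: "'a::comm_ring_1 bpoly"
  assumes "0 \<in> G" "\<And>a b. a \<in> G \<Longrightarrow> b \<in> G \<Longrightarrow> a - b \<in> G" "\<And>v. peval v p \<in> G"
  shows "Poly_Mapping.lookup p M \<in> G"
proof (rule lookup_in_subgroup[of G "{}"])
  show "(\<Sum>M | M \<in> Poly_Mapping.keys p \<and> {} \<subseteq> fset (mvars M).
      Poly_Mapping.lookup p M * of_bool (\<forall>j\<in>fset (mvars M). v j)) \<in> G" for v
    using assms(3)[of v] peval_superset[of "Poly_Mapping.keys p" p v] by simp
qed (use assms in auto)

lemma bpoly_eqI:
  fixes p q :: "'a::comm_ring_1 bpoly"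
  assumes "\<And>v. peval v p = peval v q"
  shows "p = q"
proof (rule poly_mapping_eqI)
  fix M
  have "Poly_Mapping.lookup (p - q) M \<in> {0}"
    by (rule lookup_in_subgroup_of_peval) (auto simp: assms)
  then show "Poly_Mapping.lookup p M = Poly_Mapping.lookup q M" by (simp add: lookup_minus)
qed

lemma int_coeffs_iff: "int_coeffs p \<longleftrightarrow> (\<forall>v. peval v p \<in> \<int>)"
  unfolding int_coeffs_def
  by (auto intro: lookup_in_subgroup_of_peval)
    (auto simp: peval_superset[of "Poly_Mapping.keys p"] intro!: Ints_sum)

text \<open>Comparing the values at \<open>y\<close> true and \<open>y\<close> false isolates the
  monomials that contain \<open>y\<close>, so the inversion is run above \<open>{y}\<close>.\<close>

lemma notin_pvarsI:
  fixes p :: "'a::comm_ring_1 bpoly"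
  assumes "\<And>v. peval (v(y := False)) p = peval (v(y := True)) p"
  shows "y \<notin> pvars p"
proof -
  have "Poly_Mapping.lookup p M \<in> {0}" if "y \<in> fset (mvars M)" for M
  proof (rule lookup_in_subgroup[of _ "{y}"])
    fix v :: "nat \<Rightarrow> bool" assume "\<And>j. j \<in> {y} \<Longrightarrow> v j"
    then have v: "v(y := True) = v" by (simp add: fun_upd_idem)
    let ?K = "Poly_Mapping.keys p"
    let ?f = "\<lambda>v M. Poly_Mapping.lookup p M * of_bool (\<forall>j\<in>fset (mvars M). v j)"
    have indep: "(\<forall>j\<in>fset (mvars M). (v(y := False)) j) = (\<forall>j\<in>fset (mvars M). v j)"
      if "y \<notin> fset (mvars M)" for M
      using that by (intro ball_cong) auto
    have "0 = peval v p - peval (v(y := False)) p" using assms[of v] v by simp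
    also have "\<dots> = (\<Sum>M\<in>?K. ?f v M - ?f (v(y := False)) M)"
      by (simp add: peval_superset[of ?K p] sum_subtractf)
    also have "\<dots> = (\<Sum>M | M \<in> ?K \<and> {y} \<subseteq> fset (mvars M). ?f v M - ?f (v(y := False)) M)"
      by (rule sum.mono_neutral_right) (auto simp: indep simp del: fun_upd_apply)
    also have "\<dots> = (\<Sum>M | M \<in> ?K \<and> {y} \<subseteq> fset (mvars M). ?f v M)"
      by (rule sum.cong) auto
    finally show "(\<Sum>M | M \<in> ?K \<and> {y} \<subseteq> fset (mvars M). ?f v M) \<in> {0}" by simp
  qed (use that in auto)
  then show ?thesis by (auto simp: pvars_def in_keys_iff)
qed

text \<open>On the values 0 and 1 the expression a + b - 2ab is exclusive or. From here on
  \<open>lift\<close> is handled through its values alone.\<close>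

lemma peval_lift [simp]: "peval v (lift Q) = of_bool (peval v Q = 1)"
proof (induction Q rule: bpoly_bit_induct)
  case zero
  show ?case by simp
next
  case (add M Q)
  show ?case
    by (cases "peval v Q") (auto simp: lift_add is_lift_single[OF is_lift_lift] add)
qed

text \<open>Assignments are total functions with default \<open>False\<close> outside
  \<open>V\<close>. Unlike extensional functions they can be passed to \<open>peval\<close>
  directly, and removing a variable amounts to setting it to \<open>False\<close>.\<close>

definition asg :: "nat set \<Rightarrow> (nat \<Rightarrow> bool) set"
  where "asg V = {v. \<forall>j. v j \<longrightarrow> j \<in> V}"

text \<open>Lagrange interpolation on the Boolean cube: the two products form the indicator of the
  point \<open>A\<close>.\<close>

definition ipoly :: "nat set \<Rightarrow> ((nat \<Rightarrow> bool) \<Rightarrow> 'a::comm_ring_1) \<Rightarrow> 'a bpoly"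
  where "ipoly V f = (\<Sum>A\<in>Pow V. Cst (f (\<lambda>j. j \<in> A)) * (\<Prod>j\<in>A. X j) * (\<Prod>j\<in>V - A. 1 - X j))"

lemma peval_ipoly [simp]:
  assumes "finite V"
  shows "peval v (ipoly V f) = f (\<lambda>j. j \<in> V \<and> v j)"
proof -
  have "(\<Prod>j\<in>A. of_bool (v j)) * (\<Prod>j\<in>V - A. 1 - of_bool (v j)) =
      (of_bool (A = {j\<in>V. v j}) :: 'a)" if "A \<subseteq> V" for A
  proof -
    have "1 - of_bool (v j) = (of_bool (\<not> v j) :: 'a)" for j by simp
    then show ?thesis
      using that assms by (auto simp only: prod_of_bool_eq finite_subset finite_Diff) auto
  qed
  then have "peval v (ipoly V f) = (\<Sum>A\<in>Pow V. f (\<lambda>j. j \<in> A) * of_bool (A = {j\<in>V. v j}))"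
    unfolding ipoly_def by (simp add: mult.assoc)
  also have "\<dots> = f (\<lambda>j. j \<in> {j\<in>V. v j})"
    using assms by (subst sum.remove[of _ "{j\<in>V. v j}"]) auto
  finally show ?thesis by simp
qed

lemma pvars_subsetI:
  assumes "\<And>y v. y \<notin> V \<Longrightarrow> peval (v(y := False)) p = peval (v(y := True)) (p :: 'a::comm_ring_1 bpoly)"
  shows "pvars p \<subseteq> V"
  using notin_pvarsI[of _ p] assms by blast

lemma restrict_upd_notin: "y \<notin> V \<Longrightarrow> (\<lambda>j. j \<in> V \<and> (v(y := b)) j) = (\<lambda>j. j \<in> V \<and> v j)"
  by auto

lemma pvars_ipoly: "finite V \<Longrightarrow> pvars (ipoly V f) \<subseteq> V"
  by (rule pvars_subsetI) (simp add: restrict_upd_notin del: fun_upd_apply)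


section \<open>Soundness\<close>

definition e2pi :: "real \<Rightarrow> complex"
  where "e2pi r = exp (2 * \<i> * of_real pi * of_real r)"

lemma e2pi_add: "e2pi (a + b) = e2pi a * e2pi b"
  by (simp add: e2pi_def distrib_left exp_add)

lemma e2pi_0 [simp]: "e2pi 0 = 1"
  by (simp add: e2pi_def)

lemma e2pi_Ints: "a \<in> \<int> \<Longrightarrow> e2pi a = 1"
  using cis_multiple_2pi[of a] by (simp add: e2pi_def cis_conv_exp mult_ac)

lemma e2pi_cong: "a - b \<in> \<int> \<Longrightarrow> e2pi a = e2pi b"
  using e2pi_add[of "a - b" b] by (simp add: e2pi_Ints)

lemma e2pi_half [simp]: "e2pi (1 / 2) = - 1"
  by (simp add: e2pi_def mult.commute)

lemma e2pi_power: "e2pi (real n * r) = e2pi r ^ n"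
  by (induction n) (simp_all add: distrib_right e2pi_add)

lemma finite_asg: "finite V \<Longrightarrow> finite (asg V)"
proof (rule finite_subset[of _ "(\<lambda>A j. j \<in> A) ` Pow V"])
  show "asg V \<subseteq> (\<lambda>A j. j \<in> A) ` Pow V"
  proof
    fix v assume "v \<in> asg V"
    then show "v \<in> (\<lambda>A j. j \<in> A) ` Pow V"
      by (intro image_eqI[of _ _ "{j. v j}"]) (auto simp: asg_def)
  qed
qed simp

lemma sum_asg_split:
  fixes F :: "(nat \<Rightarrow> bool) \<Rightarrow> 'a::comm_monoid_add"
  assumes "finite V" "y \<in> V"
  shows "(\<Sum>v\<in>asg V. F v) = (\<Sum>v\<in>asg (V - {y}). F (v(y := False)) + F (v(y := True)))"
proof -
  let ?W = "asg (V - {y})"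
  let ?u = "\<lambda>v :: nat \<Rightarrow> bool. v(y := True)"
  have inj: "inj_on ?u ?W"
  proof (rule inj_onI)
    fix v w assume "v \<in> ?W" "w \<in> ?W" "?u v = ?u w"
    then show "v = w" by (auto simp: asg_def fun_eq_iff split: if_splits)
  qed
  have "asg V = ?W \<union> ?u ` ?W"
  proof (intro equalityI subsetI)
    fix v assume v: "v \<in> asg V"
    show "v \<in> ?W \<union> ?u ` ?W"
    proof (cases "v y")
      case True
      then have "v = ?u (v(y := False))" by (simp add: fun_upd_idem)
      moreover have "v(y := False) \<in> ?W" using v by (auto simp: asg_def)
      ultimately show ?thesis by blast
    next
      case False
      then show ?thesis using v by (auto simp: asg_def)
    qed
  qed (use assms in \<open>auto simp: asg_def split: if_splits\<close>)
  moreover have "?W \<inter> ?u ` ?W = {}" by (auto simp: asg_def dest: spec[of _ y])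
  ultimately have "(\<Sum>v\<in>asg V. F v) = (\<Sum>v\<in>?W. F v) + (\<Sum>v\<in>?u ` ?W. F v)"
    using assms by (simp add: sum.union_disjoint finite_asg)
  also have "\<dots> = (\<Sum>v\<in>?W. F v + F (?u v))"
    by (simp add: sum.reindex[OF inj] sum.distrib)
  also have "\<dots> = (\<Sum>v\<in>?W. F (v(y := False)) + F (?u v))"
  proof (rule sum.cong)
    fix v assume "v \<in> ?W"
    then have "v(y := False) = v" by (intro fun_upd_idem) (auto simp: asg_def)
    then show "F v + F (?u v) = F (v(y := False)) + F (?u v)" by simp
  qed simp
  finally show ?thesis .
qed

definition path_amp :: "sop \<Rightarrow> bit list \<Rightarrow> bit list \<Rightarrow> (nat \<Rightarrow> bool) \<Rightarrow> complex"
  where "path_amp t x w v =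
    e2pi (peval v (phase t)) * ketbra (map (peval v) (kets t)) (map (peval v) (bras t)) x w"

text \<open>Containment of variables is tested on values, which avoids computing the monomials of
  substituted polynomials.\<close>

lemma wf_sopI:
  assumes "finite (svars t)"
    and "\<And>y v. y \<notin> svars t \<Longrightarrow> peval (v(y := False)) (phase t) = peval (v(y := True)) (phase t)"
    and "\<And>y v q. y \<notin> svars t \<Longrightarrow> q \<in> set (kets t) \<union> set (bras t) \<Longrightarrow>
      peval (v(y := False)) q = peval (v(y := True)) q"
  shows "wf_sop t"
proof -
  have "pvars q \<subseteq> svars t" if "q \<in> set (kets t) \<union> set (bras t)" for q
    using assms(3) that by (intro pvars_subsetI) auto
  then show ?thesis
    unfolding wf_sop_def using assms by (auto simp: Var_def intro!: pvars_subsetI)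
qed

lemma wf_sop_peval_phase:
  assumes "wf_sop t" "\<And>j. j \<in> svars t \<Longrightarrow> v j = w j"
  shows "peval v (phase t) = peval w (phase t)"
  using assms by (intro peval_cong) (auto simp: wf_sop_def)

lemma wf_sop_peval_ketbra:
  assumes "wf_sop t" "\<And>j. j \<in> svars t \<Longrightarrow> v j = w j" "q \<in> set (kets t) \<union> set (bras t)"
  shows "peval v q = peval w q"
  using assms by (intro peval_cong) (auto simp: wf_sop_def Var_def)

lemma path_amp_cong:
  assumes "wf_sop t" "\<And>j. j \<in> svars t \<Longrightarrow> v j = w j"
  shows "path_amp t x y v = path_amp t x y w"
proof -
  have "map (peval v) (kets t) = map (peval w) (kets t)" "map (peval v) (bras t) = map (peval w) (bras t)"
    using wf_sop_peval_ketbra[OF assms] by (auto intro!: map_cong)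
  then show ?thesis using wf_sop_peval_phase[OF assms] by (simp only: path_amp_def)
qed

lemma interp_eq_sum_asg:
  assumes "wf_sop t"
  shows "interp t x w = of_real (scalar t) * (\<Sum>v\<in>asg (svars t). path_amp t x w v)"
proof -
  have "(\<Sum>v\<in>svars t \<rightarrow>\<^sub>E UNIV. path_amp t x w v) = (\<Sum>v\<in>asg (svars t). path_amp t x w v)"
    by (rule sum.reindex_bij_witness[where i = "\<lambda>v. restrict v (svars t)"
          and j = "\<lambda>v j. j \<in> svars t \<and> v j"])
      (auto simp: asg_def PiE_def extensional_def fun_eq_iff intro!: path_amp_cong[OF assms])
  then show ?thesis by (simp add: interp_def path_amp_def e2pi_def)
qed

lemma peval_psubst_upd_lift [simp]:
  "peval v (psubst (X(y := lift Q)) P) = peval (v(y := (peval v Q = 1))) P"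
  by (rule peval_psubst) simp

lemma peval_psubst_upd_bit [simp]:
  "peval v (psubst (X(y := Q)) (q :: bit bpoly)) = peval (v(y := (peval v Q = 1))) q"
  by (rule peval_psubst) (cases "peval v Q"; simp)

lemma peval_psubst_rename:
  "peval v (psubst (\<lambda>j. X (f j)) (p :: 'a::comm_ring_1 bpoly)) = peval (v \<circ> f) p"
  by (rule peval_psubst) simp

text \<open>\<open>Q\<close> in kets and bras and \<open>lift Q\<close> in the phase take the same
  Boolean value, so a substitution just redirects each path to one with \<open>y\<close>
  updated.\<close>

lemma path_amp_sop_subst:
  "path_amp (sop_subst y Q t) x w v = path_amp t x w (v(y := (peval v Q = 1)))"
  by (simp add: path_amp_def sop_subst_def o_def)

lemma path_amp_SOP:
  "path_amp (SOP s V P Os Is) x w v =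
    e2pi (peval v P) * ketbra (map (peval v) Os) (map (peval v) Is) x w"
  by (simp add: path_amp_def)

lemma interp_sop_ident:
  assumes "sop_ident t u"
  shows "interp t = interp u"
proof (intro ext)
  fix x w
  from assms obtain f where wf: "wf_sop t" "wf_sop u" and f: "inj_on f (svars t)"
      "svars u = f ` svars t" "scalar u = scalar t"
      "int_coeffs (phase u - psubst (\<lambda>j. X (f j)) (phase t))"
      "kets u = map (psubst (\<lambda>j. X (f j))) (kets t)"
      "bras u = map (psubst (\<lambda>j. X (f j))) (bras t)"
    unfolding sop_ident_def by blast
  have amp: "path_amp u x w v = path_amp t x w (v \<circ> f)" for v
  proof -
    have "peval v (phase u) - peval (v \<circ> f) (phase t) \<in> \<int>"
      using f(4) by (simp add: int_coeffs_iff peval_psubst_rename)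
    then show ?thesis
      using f by (simp add: path_amp_def o_def peval_psubst_rename[unfolded o_def] e2pi_cong)
  qed
  have "(\<Sum>v\<in>asg (svars t). path_amp t x w v) = (\<Sum>v\<in>asg (svars u). path_amp u x w v)"
    by (rule sum.reindex_bij_witness[where i = "\<lambda>v j. j \<in> svars t \<and> v (f j)"
          and j = "\<lambda>v i. \<exists>j\<in>svars t. f j = i \<and> v j"])
      (use f(1,2) in \<open>auto simp: asg_def fun_eq_iff amp inj_on_eq_iff intro!: path_amp_cong[OF wf(1)]\<close>)
  then show "interp t x w = interp u x w"
    using wf f(3) by (simp add: interp_eq_sum_asg)
qed

lemma path_amp_upd:
  assumes "y \<notin> pvars P" "y \<notin> Var (set Os \<union> set Is)"
  shows "path_amp (SOP s V P Os Is) x w (v(y := b)) = path_amp (SOP s V P Os Is) x w v"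
proof -
  have "map (peval (v(y := b))) Os = map (peval v) Os" "map (peval (v(y := b))) Is = map (peval v) Is"
    using assms(2) by (auto simp: Var_def intro!: map_cong)
  then show ?thesis using assms(1) by (simp only: path_amp_SOP peval_upd not_False_eq_True)
qed

section \<open>Soundness of the individual rules\<close>

lemma wf_sop_subst:
  assumes "wf_sop t" "pvars Q \<subseteq> svars t"
  shows "wf_sop (sop_subst y Q t)"
proof (rule wf_sopI)
  fix z v assume z: "z \<notin> svars (sop_subst y Q t)"
  then have Q: "peval (v(z := b)) Q = peval v Q" for b
    using assms(2) by (auto simp: sop_subst_def intro!: peval_upd)
  have eq: "(v(z := False, y := c)) j = (v(z := True, y := c)) j" if "j \<in> svars t" for c j
    using z that by (auto simp: sop_subst_def)
  have ph: "peval (v(z := False, y := c)) (phase t) = peval (v(z := True, y := c)) (phase t)" for c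
    by (rule wf_sop_peval_phase[OF assms(1)]) (rule eq)
  have kb: "peval (v(z := False, y := c)) q = peval (v(z := True, y := c)) q"
    if "q \<in> set (kets t) \<union> set (bras t)" for c q
    by (rule wf_sop_peval_ketbra[OF assms(1) _ that]) (rule eq)
  show "peval (v(z := False)) (phase (sop_subst y Q t)) = peval (v(z := True)) (phase (sop_subst y Q t))"
    using ph by (simp add: sop_subst_def Q)
  fix q assume "q \<in> set (kets (sop_subst y Q t)) \<union> set (bras (sop_subst y Q t))"
  then show "peval (v(z := False)) q = peval (v(z := True)) q"
    using kb by (auto simp: sop_subst_def Q)
qed (use assms in \<open>auto simp: sop_subst_def wf_sop_def\<close>)

lemma wf_remove_var_sop_subst:
  assumes "wf_sop t" "pvars Q \<subseteq> svars t - {y}"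
  shows "wf_sop (remove_var y (sop_subst y Q t))" (is "wf_sop ?u")
proof (rule wf_sopI)
  fix z v assume z: "z \<notin> svars ?u"
  then have Q: "peval (v(z := b)) Q = peval v Q" for b
    using assms(2) by (auto simp: sop_subst_def remove_var_def intro!: peval_upd)
  have eq: "(v(z := False, y := c)) j = (v(z := True, y := c)) j" if "j \<in> svars t" for c j
    using z that by (auto simp: sop_subst_def remove_var_def)
  have ph: "peval (v(z := False, y := c)) (phase t) = peval (v(z := True, y := c)) (phase t)" for c
    by (rule wf_sop_peval_phase[OF assms(1)]) (rule eq)
  have kb: "peval (v(z := False, y := c)) q = peval (v(z := True, y := c)) q"
    if "q \<in> set (kets t) \<union> set (bras t)" for c q
    by (rule wf_sop_peval_ketbra[OF assms(1) _ that]) (rule eq)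
  show "peval (v(z := False)) (phase ?u) = peval (v(z := True)) (phase ?u)"
    using ph by (simp add: sop_subst_def remove_var_def Q)
  fix q assume "q \<in> set (kets ?u) \<union> set (bras ?u)"
  then show "peval (v(z := False)) q = peval (v(z := True)) q"
    using kb by (auto simp: sop_subst_def remove_var_def Q)
qed (use assms in \<open>auto simp: sop_subst_def remove_var_def wf_sop_def\<close>)

text \<open>Since \<open>y\<close> does not occur in \<open>Q'\<close>, the map y -> y +
  \<open>Q'\<close> is an involution on assignments, so the substitution only permutes the paths.
  This covers the rules \<open>ket\<close> and \<open>bra\<close>.\<close>

lemma interp_sop_subst_transvection:
  assumes wf: "wf_sop t" and y: "y \<in> svars t" and Q: "y \<notin> pvars Q'" "pvars (X y + Q') \<subseteq> svars t"
  shows "interp (sop_subst y (X y + Q') t) = interp t"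
proof (intro ext)
  fix x w
  let ?\<phi> = "\<lambda>v. v(y := (v y \<noteq> (peval v Q' = 1)))"
  have wf': "wf_sop (sop_subst y (X y + Q') t)"
    using wf_sop_subst[OF wf Q(2)] .
  have ev: "(peval v (X y + Q') = 1) = (v y \<noteq> (peval v Q' = 1))" for v
    by (cases "peval v Q'") auto
  have inv: "?\<phi> (?\<phi> v) = v" for v
    using Q by (auto simp: fun_upd_idem_iff)
  have asg: "?\<phi> v \<in> asg (svars t)" if "v \<in> asg (svars t)" for v
    using that y by (auto simp: asg_def)
  have "(\<Sum>v\<in>asg (svars t). path_amp t x w (?\<phi> v)) = (\<Sum>v\<in>asg (svars t). path_amp t x w v)"
    by (rule sum.reindex_bij_witness[where i = ?\<phi> and j = ?\<phi>]) (simp_all only: inv asg)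
  moreover have "path_amp (sop_subst y (X y + Q') t) x w v = path_amp t x w (?\<phi> v)" for v
    by (simp only: path_amp_sop_subst ev)
  ultimately show "interp (sop_subst y (X y + Q') t) x w = interp t x w"
    using wf wf' by (simp add: interp_eq_sum_asg) (simp add: sop_subst_def)
qed

lemma interp_Elim:
  assumes wf: "wf_sop (SOP s V P Os Is)" and y: "y \<in> V" "y \<notin> pvars P \<union> Var (set Os \<union> set Is)"
  shows "interp (SOP s V P Os Is) = interp (SOP (2 * s) (V - {y}) P Os Is)"
proof (intro ext)
  fix x w
  have wf': "wf_sop (SOP (2 * s) (V - {y}) P Os Is)"
    using wf y by (auto simp: wf_sop_def Var_def)
  have "finite V" using wf by (simp add: wf_sop_def)
  then have "(\<Sum>v\<in>asg V. path_amp (SOP s V P Os Is) x w v) =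
    2 * (\<Sum>v\<in>asg (V - {y}). path_amp (SOP (2 * s) (V - {y}) P Os Is) x w v)"
    using y by (simp add: sum_asg_split[OF _ y(1)] path_amp_upd sum_distrib_left)
      (simp add: path_amp_SOP)
  then show "interp (SOP s V P Os Is) x w = interp (SOP (2 * s) (V - {y}) P Os Is) x w"
    using wf wf' by (simp add: interp_eq_sum_asg)
qed

text \<open>Summing over \<open>y\<close> factors out e(a) + e(a+b). With a = 0, b = 1/2 the factor
  vanishes, which serves the rule \<open>Z\<close>; with a = 1/8, b = 3/4 it serves the rule
  \<open>sqrt2\<close>. The parameters \<open>s'\<close> and \<open>V'\<close> are free because
  \<open>path_amp\<close> looks at neither scalar nor variable set.\<close>

lemma sum_asg_affine_phase:
  assumes wf: "wf_sop (SOP s V (Cst a + Cst b * X y + R) Os Is)" (is "wf_sop ?t")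
    and y: "y \<in> V" "y \<notin> pvars R \<union> Var (set Os \<union> set Is)"
  shows "(\<Sum>v\<in>asg V. path_amp ?t x w v) =
    (e2pi a + e2pi (a + b)) * (\<Sum>v\<in>asg (V - {y}). path_amp (SOP s' V' R Os Is) x w v)"
proof -
  let ?u = "SOP s' V' R Os Is"
  have "path_amp ?t x w (v(y := c)) = e2pi (a + b * of_bool c) * path_amp ?u x w v" for v c
  proof -
    have "path_amp ?t x w (v(y := c)) = e2pi (a + b * of_bool c) * path_amp ?u x w (v(y := c))"
      by (simp add: path_amp_SOP e2pi_add)
    also have "path_amp ?u x w (v(y := c)) = path_amp ?u x w v"
      using y by (intro path_amp_upd) auto
    finally show ?thesis .
  qed
  moreover have "finite V" using wf by (simp add: wf_sop_def)
  ultimately show ?thesis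
    using y by (simp add: sum_asg_split[OF _ y(1)] sum_distrib_left distrib_right)
qed

lemma interp_Z_eq_0:
  assumes wf: "wf_sop (SOP s V (Cst (1/2) * X y + R) Os Is)"
    and y: "y \<in> V" "y \<notin> pvars R \<union> Var (set Os \<union> set Is)"
  shows "interp (SOP s V (Cst (1/2) * X y + R) Os Is) = (\<lambda>x w. 0)"
proof (intro ext)
  fix x w
  have eq: "Cst (1/2) * X y + R = Cst 0 + Cst (1/2) * X y + R"
    by (simp add: Cst_def)
  show "interp (SOP s V (Cst (1/2) * X y + R) Os Is) x w = 0"
    using sum_asg_affine_phase[of s V 0 "1/2" y R Os Is x w s V] wf y
    by (simp add: interp_eq_sum_asg) (simp add: eq[symmetric])
qed

text \<open>1/8 + 3/4 is -1/8 modulo 1, so the two terms are conjugate and add up to twice the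
  cosine of pi/4.\<close>

lemma e2pi_sqrt2: "e2pi (1/8) + e2pi (1/8 + 3/4) = of_real (sqrt 2)"
proof -
  have cis: "e2pi r = cis (2 * pi * r)" for r
    by (simp add: e2pi_def cis_conv_exp mult_ac)
  have "e2pi (1/8 + 3/4) = e2pi (- (1/8))" by (rule e2pi_cong) simp
  then show ?thesis
    by (simp add: cis complex_eq_iff cos_45 sin_45)
qed

text \<open>Fix all variables except \<open>y0\<close> and \<open>yi\<close>. If \<open>Q\<close> is
  1, summing over \<open>y0\<close> keeps only the value 1 + \<open>Q'\<close> of \<open>yi\<close>.
  If \<open>Q\<close> is 0, then \<open>Q * Q' = Q'\<close> forces \<open>Q'\<close> to be 0, and
  the remaining phase y0/2 makes both sides vanish.\<close>

lemma interp_HHgen: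
  assumes t: "t = SOP s V (Cst (1/2) * X y0 * (X yi * lift Q + lift Q' + 1) + R) Os Is"
    and wf: "wf_sop t"
    and y: "y0 \<in> V" "yi \<in> V" "y0 \<noteq> yi" and V: "Var {Q, Q'} \<subseteq> V" and QQ': "Q * Q' = Q'"
    and y0: "y0 \<notin> Var {Q, Q'} \<union> pvars R \<union> Var (set Os \<union> set Is)" and yi: "yi \<notin> Var {Q, Q'}"
  shows "interp t = interp (remove_var yi (sop_subst yi (1 + Q') t))"
proof (intro ext)
  fix x w
  let ?u = "remove_var yi (sop_subst yi (1 + Q') t)"
  let ?W = "asg (V - {yi} - {y0})"
  have wf': "wf_sop ?u"
  proof (rule wf_remove_var_sop_subst[OF wf])
    have "pvars (1 + Q') \<subseteq> pvars Q'" by (rule pvars_subsetI) simp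
    then show "pvars (1 + Q') \<subseteq> svars t - {yi}" using V yi t by (auto simp: Var_def)
  qed
  have fin: "finite V" using wf t by (simp add: wf_sop_def)
  define H where "H = path_amp (SOP s V R Os Is) x w"
  have amp: "path_amp t x w (v(y0 := c, yi := d)) =
    (if c \<and> (d \<and> peval v Q = 1) = (peval v Q' = 1) then - 1 else 1) * H (v(yi := d))" for v c d
  proof -
    have "path_amp t x w (v(y0 := c, yi := d)) =
      e2pi (of_bool c / 2 * (of_bool d * of_bool (peval v Q = 1) + of_bool (peval v Q' = 1) + 1)) *
      H (v(y0 := c, yi := d))"
      using y y0 yi by (simp add: t H_def path_amp_SOP e2pi_add Var_def)
    also have "H (v(y0 := c, yi := d)) = H (v(yi := d))"
      unfolding H_def using y y0 by (subst fun_upd_twist) (auto intro!: path_amp_upd)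
    also have "e2pi (of_bool c / 2 * (of_bool d * of_bool (peval v Q = 1) + of_bool (peval v Q' = 1) + 1)) =
      (if c \<and> (d \<and> peval v Q = 1) = (peval v Q' = 1) then - 1 else 1)"
      \<comment> \<open>The exponent 3/2 arises when \<open>c\<close> and \<open>d\<close> are true
        and both \<open>Q\<close> and \<open>Q'\<close> evaluate to 1.\<close>
      using e2pi_add[of 1 "1/2"] by (auto simp: e2pi_Ints)
    finally show ?thesis .
  qed
  have "path_amp t x w (v(y0 := False, yi := False)) + path_amp t x w (v(y0 := False, yi := True)) +
      (path_amp t x w (v(y0 := True, yi := False)) + path_amp t x w (v(y0 := True, yi := True))) =
    path_amp t x w (v(y0 := False, yi := (peval v Q' \<noteq> 1))) +
      path_amp t x w (v(y0 := True, yi := (peval v Q' \<noteq> 1)))" for v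
  proof -
    have "peval v Q * peval v Q' = peval v Q'"
      using QQ' by (metis peval_mult)
    then show ?thesis
      by (cases "peval v Q"; cases "peval v Q'") (simp_all add: amp)
  qed
  moreover have "path_amp ?u x w (v(y0 := c)) = path_amp t x w (v(y0 := c, yi := (peval v Q' \<noteq> 1)))" for v c
  proof -
    have "(peval (v(y0 := c)) (1 + Q') = 1) = (peval v Q' \<noteq> 1)"
      using y0 by (cases "peval v Q'") (simp_all add: Var_def)
    moreover have "path_amp ?u x w v' = path_amp (sop_subst yi (1 + Q') t) x w v'" for v'
      by (simp add: remove_var_def path_amp_def)
    ultimately show ?thesis by (simp only: path_amp_sop_subst)
  qed
  ultimately have "(\<Sum>v\<in>asg V. path_amp t x w v) = (\<Sum>v\<in>asg (V - {yi}). path_amp ?u x w v)"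
    using fin y by (simp add: sum_asg_split[of V yi] sum_asg_split[of "V - {yi}" y0])
  then show "interp t x w = interp ?u x w"
    using wf wf' by (simp add: interp_eq_sum_asg) (simp add: t remove_var_def sop_subst_def)
qed

lemma interp_th_step:
  assumes "th_step t u"
  shows "interp t = interp u"
  using assms
proof cases
  case (Elim s V P Os Is y0)
  then show ?thesis using interp_Elim by metis
next
  case HHgen
  then show ?thesis using interp_HHgen by metis
next
  case (ket s V P Os Is y0 i O')
  have "Os ! i \<in> set Os" using ket(5) by (rule nth_mem)
  then have "pvars (Os ! i) \<subseteq> V" using ket by (auto simp: wf_sop_def Var_def)
  then show ?thesis
    using interp_sop_subst_transvection[of t y0 O'] ket by (simp add: Var_def)
next
  case (bra s V P Os Is y0 i I')
  have "Is ! i \<in> set Is" using bra(5) by (rule nth_mem)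
  then have "pvars (Is ! i) \<subseteq> V" using bra by (auto simp: wf_sop_def Var_def)
  then show ?thesis
    using interp_sop_subst_transvection[of t y0 I'] bra by (simp add: Var_def)
next
  case (Z s V y0 R Os Is)
  \<comment> \<open>The right-hand side of the rule is itself of the vanishing form, with remainder
    0.\<close>
  have "interp u = interp (SOP 1 {y0} (Cst (1/2) * X y0 + 0)
      (replicate (length Os) 0) (replicate (length Is) 0))"
    using Z by simp
  also have "\<dots> = (\<lambda>x w. 0)"
    by (rule interp_Z_eq_0)
      (auto simp: Var_def pvars_def intro!: wf_sopI split: if_splits)
  finally show ?thesis using Z interp_Z_eq_0 by metis
next
  case (sqrt2 s V y0 R Os Is)
  \<comment> \<open>Well-formedness of \<open>t\<close> bounds the variables of the whole phase. For
    z \<noteq> y0 the summands other than \<open>R\<close> are unaffected by \<open>z\<close>, so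
    independence of \<open>z\<close> passes to \<open>R\<close>.\<close>
  have wf': "wf_sop u"
  proof (rule wf_sopI)
    fix z v q assume z: "z \<notin> svars u"
    show "peval (v(z := False)) (phase u) = peval (v(z := True)) (phase u)"
    proof (cases "z = y0")
      case False
      then have "peval (v(z := False)) (phase t) = peval (v(z := True)) (phase t)"
        using z sqrt2 by (intro wf_sop_peval_phase) auto
      then show ?thesis using False sqrt2 by simp
    qed (use sqrt2 in auto)
    assume "q \<in> set (kets u) \<union> set (bras u)"
    then have "z \<notin> pvars q" using sqrt2 z by (auto simp: wf_sop_def Var_def)
    then show "peval (v(z := False)) q = peval (v(z := True)) q" by simp
  qed (use sqrt2 in \<open>auto simp: wf_sop_def\<close>)
  show ?thesis
  proof (intro ext)
    fix x w
    show "interp t x w = interp u x w"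
      using sqrt2 wf' sum_asg_affine_phase[of s V "1/8" "3/4" y0 R Os Is x w "sqrt 2 * s" "V - {y0}"] e2pi_sqrt2
      by (simp add: interp_eq_sum_asg)
  qed
qed

theorem interp_th_equiv:
  assumes "t \<sim>\<^sub>T\<^sub>H u"
  shows "interp t = interp u"
  using assms unfolding th_equiv_def
  by (induction rule: equivclp_induct) (use interp_sop_ident interp_th_step in metis)+


section \<open>Morphisms given by functions\<close>

lemma th_equiv_refl [simp]: "t \<sim>\<^sub>T\<^sub>H t"
  by (simp add: th_equiv_def)

lemma th_equiv_sym: "t \<sim>\<^sub>T\<^sub>H u \<Longrightarrow> u \<sim>\<^sub>T\<^sub>H t"
  unfolding th_equiv_def by (rule equivclp_sym)

lemma th_equiv_trans [trans]: "t \<sim>\<^sub>T\<^sub>H u \<Longrightarrow> u \<sim>\<^sub>T\<^sub>H r \<Longrightarrow> t \<sim>\<^sub>T\<^sub>H r"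
  unfolding th_equiv_def by (rule equivclp_trans)

lemma th_equiv_ident: "sop_ident t u \<Longrightarrow> t \<sim>\<^sub>T\<^sub>H u"
  unfolding th_equiv_def by (auto intro: r_into_equivclp)

lemma th_equiv_step: "th_step t u \<Longrightarrow> t \<sim>\<^sub>T\<^sub>H u"
  unfolding th_equiv_def by (auto intro: r_into_equivclp)

text \<open>Up to renaming and integer phases every morphism arises in this way. Only the values of the
  functions on \<open>asg V\<close> matter.\<close>

definition mk :: "nat \<Rightarrow> real \<Rightarrow> nat set \<Rightarrow> ((nat \<Rightarrow> bool) \<Rightarrow> real) \<Rightarrow> ((nat \<Rightarrow> bool) \<Rightarrow> bool) list \<Rightarrow> sop"
  where "mk m s V p ls = SOP s V (ipoly V p)
    (map (\<lambda>f. ipoly V (\<lambda>v. of_bool (f v))) (take m ls))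
    (map (\<lambda>f. ipoly V (\<lambda>v. of_bool (f v))) (drop m ls))"

lemma wf_sop_SOP_iff:
  "wf_sop (SOP s V P Os Is) \<longleftrightarrow> finite V \<and> pvars P \<subseteq> V \<and> (\<forall>q\<in>set Os \<union> set Is. pvars q \<subseteq> V)"
  by (auto simp: wf_sop_def Var_def)

lemma pvars_ipolyD: "x \<in> pvars (ipoly V f) \<Longrightarrow> finite V \<Longrightarrow> x \<in> V"
  using pvars_ipoly by blast

lemma wf_mk: "finite V \<Longrightarrow> wf_sop (mk m s V p ls)"
  unfolding mk_def wf_sop_SOP_iff by (auto dest: pvars_ipolyD)

lemma restrict_asg: "v \<in> asg V \<Longrightarrow> (\<lambda>j. j \<in> V \<and> v j) = v"
  by (auto simp: asg_def)

lemma restrict_in_asg [simp]: "(\<lambda>j. j \<in> V \<and> v j) \<in> asg V"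
  by (simp add: asg_def)

lemma restrict_asg_insert: "v \<in> asg (insert y V) \<Longrightarrow> y \<notin> V \<Longrightarrow> (\<lambda>j. j \<in> V \<and> v j) = v(y := False)"
  by (auto simp: asg_def fun_eq_iff)

lemma asg_upd_False: "v \<in> asg (insert y V) \<Longrightarrow> v(y := False) \<in> asg V"
  by (auto simp: asg_def)

lemma asg_upd_insert: "v \<in> asg V \<Longrightarrow> v(y := c) \<in> asg (insert y V)"
  by (auto simp: asg_def)

lemma asg_mono: "v \<in> asg V \<Longrightarrow> V \<subseteq> W \<Longrightarrow> v \<in> asg W"
  by (auto simp: asg_def)

lemma asg_upd_True_eq:
  assumes "v \<in> asg (insert y V)" "\<And>v. v \<in> asg V \<Longrightarrow> f (v(y := True)) = f v"
  shows "f (v(y := False)) = f v"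
proof (cases "v y")
  case True
  then show ?thesis using assms(2)[OF asg_upd_False[OF assms(1)]] by (simp add: fun_upd_idem)
next
  case False
  then show ?thesis by (simp add: fun_upd_idem)
qed

lemma psubst_X [simp]: "psubst (\<lambda>j. X j) (p :: 'a::comm_ring_1 bpoly) = p"
  by (rule bpoly_eqI) (simp add: peval_psubst_rename o_def)

lemma bit_eqI: "((a :: bit) = 1) = (b = 1) \<Longrightarrow> a = b"
  by (cases a; cases b) auto

text \<open>Identification leaves no slack on kets and bras apart from renaming, so the lists must
  be literally equal; this holds because a polynomial with variables in \<open>V\<close> is
  determined by its values on \<open>asg V\<close>.\<close>

lemma map_ipoly_eq:
  fixes qs :: "bit bpoly list"
  assumes "finite V" "\<And>q. q \<in> set qs \<Longrightarrow> pvars q \<subseteq> V"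
    and "\<And>v. v \<in> asg V \<Longrightarrow> map (\<lambda>q. peval v q = 1) qs = map (\<lambda>f. f v) fs"
  shows "map (\<lambda>f. ipoly V (\<lambda>v. of_bool (f v))) fs = qs"
proof (rule nth_equalityI)
  show len: "length (map (\<lambda>f. ipoly V (\<lambda>v. of_bool (f v) :: bit)) fs) = length qs"
    \<comment> \<open>The constant \<open>False\<close> lies in every \<open>asg V\<close>; one
      common assignment suffices to compare lengths.\<close>
    using arg_cong[OF assms(3)[of "\<lambda>_. False"], of length] by (simp add: asg_def)
  fix i assume "i < length (map (\<lambda>f. ipoly V (\<lambda>v. of_bool (f v) :: bit)) fs)"
  then have i: "i < length fs" "i < length qs" using len by auto
  have "peval v (ipoly V (\<lambda>v. of_bool ((fs ! i) v))) = peval v (qs ! i)" for v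
  proof -
    let ?v = "\<lambda>j. j \<in> V \<and> v j"
    have "(peval ?v (qs ! i) = 1) = (fs ! i) ?v"
      using arg_cong[OF assms(3)[of ?v], of "\<lambda>l. l ! i"] i by simp
    moreover have "peval ?v (qs ! i) = peval v (qs ! i)"
      using assms(2)[of "qs ! i"] i by (intro peval_cong) auto
    ultimately show ?thesis using assms(1) by (auto intro: bit_eqI)
  qed
  then show "map (\<lambda>f. ipoly V (\<lambda>v. of_bool (f v))) fs ! i = qs ! i"
    using i by (auto intro: bpoly_eqI)
qed

text \<open>The identity renaming does it: the phases differ by a polynomial with integer values,
  hence with integer coefficients. Afterwards rules can be applied to whatever polynomials fit their
  syntax and the result read off as functions.\<close>

lemma th_equiv_mkI:
  assumes wf: "wf_sop (SOP s V P Os Is)"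
    and P: "\<And>v. v \<in> asg V \<Longrightarrow> peval v P - p v \<in> \<int>"
    and Os: "\<And>v. v \<in> asg V \<Longrightarrow> map (\<lambda>q. peval v q = 1) Os = map (\<lambda>f. f v) (take m ls)"
    and Is: "\<And>v. v \<in> asg V \<Longrightarrow> map (\<lambda>q. peval v q = 1) Is = map (\<lambda>f. f v) (drop m ls)"
  shows "SOP s V P Os Is \<sim>\<^sub>T\<^sub>H mk m s V p ls"
proof (rule th_equiv_ident)
  have V: "finite V" and sub: "pvars P \<subseteq> V" "\<And>q. q \<in> set Os \<union> set Is \<Longrightarrow> pvars q \<subseteq> V"
    using wf by (auto simp: wf_sop_SOP_iff)
  have eqs: "map (\<lambda>f. ipoly V (\<lambda>v. of_bool (f v))) (take m ls) = Os"
      "map (\<lambda>f. ipoly V (\<lambda>v. of_bool (f v))) (drop m ls) = Is"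
    using Os Is sub by (intro map_ipoly_eq V; blast)+
  have "peval v (ipoly V p) - peval v P \<in> \<int>" for v
  proof -
    let ?v = "\<lambda>j. j \<in> V \<and> v j"
    have "peval v P = peval ?v P" using sub by (intro peval_cong) auto
    moreover have "- (peval ?v P - p ?v) \<in> \<int>" using P[of ?v] by (intro Ints_minus) simp
    ultimately show ?thesis using V by simp
  qed
  then show "sop_ident (SOP s V P Os Is) (mk m s V p ls)"
    unfolding sop_ident_def using wf wf_mk[OF V, of m s p ls]
    by (auto intro!: exI[of _ id] simp: eqs mk_def int_coeffs_iff map_idI)
qed

lemma mk_cong:
  assumes "finite V" "\<And>v. v \<in> asg V \<Longrightarrow> p v - p' v \<in> \<int>"
    and "\<And>v. v \<in> asg V \<Longrightarrow> map (\<lambda>f. f v) ls = map (\<lambda>f. f v) ls'"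
  shows "mk m s V p ls \<sim>\<^sub>T\<^sub>H mk m s V p' ls'"
proof -
  have "map (\<lambda>f. f v) (take m ls) = map (\<lambda>f. f v) (take m ls')"
    "map (\<lambda>f. f v) (drop m ls) = map (\<lambda>f. f v) (drop m ls')" if "v \<in> asg V" for v
    using assms(3)[OF that] by (simp_all only: take_map[symmetric] drop_map[symmetric])
  then show ?thesis
    unfolding mk_def[of m s V p ls] using wf_mk[OF assms(1), of m s p ls] assms(1,2)
    by (intro th_equiv_mkI) (auto simp: mk_def restrict_asg o_def)
qed

lemma th_equiv_mk:
  assumes "wf_sop t"
  shows "t \<sim>\<^sub>T\<^sub>H mk (length (kets t)) (scalar t) (svars t) (\<lambda>v. peval v (phase t))
    (map (\<lambda>q v. peval v q = 1) (kets t @ bras t))"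
  using assms by (cases t) (auto intro!: th_equiv_mkI simp: o_def)

section \<open>The rewriting rules on functions\<close>

lemma mk_Elim:
  assumes V: "finite V" and y: "y \<notin> V"
    and p: "\<And>v. v \<in> asg V \<Longrightarrow> p (v(y := True)) = p v"
    and ls: "\<And>f v. f \<in> set ls \<Longrightarrow> v \<in> asg V \<Longrightarrow> f (v(y := True)) = f v"
  shows "mk m s (insert y V) p ls \<sim>\<^sub>T\<^sub>H mk m (2 * s) V p ls"
proof -
  let ?l = "map (\<lambda>f. ipoly V (\<lambda>v. of_bool (f v) :: bit))"
  \<comment> \<open>Interpolating over \<open>V\<close> although \<open>y\<close> is still a
    summation variable makes \<open>y\<close> disappear syntactically, as the side condition of the
    rule demands.\<close>
  let ?t = "SOP s (insert y V) (ipoly V p) (?l (take m ls)) (?l (drop m ls))"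
  have wf: "wf_sop ?t" using V by (auto simp: wf_sop_SOP_iff dest: pvars_ipolyD)
  have ls': "f (v(y := False)) = f v" if "f \<in> set ls" "v \<in> asg (insert y V)" for f v
    using asg_upd_True_eq[of v y V f] ls that by blast
  have "?t \<sim>\<^sub>T\<^sub>H mk m s (insert y V) p ls"
  proof (rule th_equiv_mkI[OF wf])
    fix v assume v: "v \<in> asg (insert y V)"
    have "p (v(y := False)) = p v" by (rule asg_upd_True_eq[where f = p, OF v p])
    then show "peval v (ipoly V p) - p v \<in> \<int>"
      using V v y by (simp add: restrict_asg_insert)
    show "map (\<lambda>q. peval v q = 1) (?l (take m ls)) = map (\<lambda>f. f v) (take m ls)"
      using V v y by (auto simp: restrict_asg_insert ls' dest: in_set_takeD)
    show "map (\<lambda>q. peval v q = 1) (?l (drop m ls)) = map (\<lambda>f. f v) (drop m ls)"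
      using V v y by (auto simp: restrict_asg_insert ls' dest: in_set_dropD)
  qed
  moreover have "?t \<sim>\<^sub>T\<^sub>H mk m (2 * s) V p ls"
  proof (rule th_equiv_step)
    have "y \<notin> pvars (ipoly V p) \<union> Var (set (?l (take m ls)) \<union> set (?l (drop m ls)))"
      using y V by (auto simp: Var_def dest: pvars_ipolyD)
    then have "th_step ?t (SOP (2 * s) (insert y V - {y}) (ipoly V p) (?l (take m ls)) (?l (drop m ls)))"
      using wf by (intro th_step.Elim[OF refl]) auto
    then show "th_step ?t (mk m (2 * s) V p ls)" using y by (simp add: mk_def)
  qed
  ultimately show ?thesis using th_equiv_sym th_equiv_trans by blast
qed

lemma mk_sqrt2:
  assumes V: "finite V" and y: "y \<notin> V"
    and p: "\<And>v. v \<in> asg V \<Longrightarrow> p (v(y := True)) = p v"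
    and ls: "\<And>f v. f \<in> set ls \<Longrightarrow> v \<in> asg V \<Longrightarrow> f (v(y := True)) = f v"
  shows "mk m s (insert y V) (\<lambda>v. 1/8 + 3/4 * of_bool (v y) + p v) ls \<sim>\<^sub>T\<^sub>H mk m (sqrt 2 * s) V p ls"
proof -
  let ?l = "map (\<lambda>f. ipoly V (\<lambda>v. of_bool (f v) :: bit))"
  let ?P = "Cst (1/8) + Cst (3/4) * X y + ipoly V p"
  let ?t = "SOP s (insert y V) ?P (?l (take m ls)) (?l (drop m ls))"
  have "pvars ?P \<subseteq> insert y V"
    using V by (intro pvars_subsetI) (simp add: restrict_upd_notin del: fun_upd_apply, simp)
  then have wf: "wf_sop ?t" using V by (auto simp: wf_sop_SOP_iff dest: pvars_ipolyD)
  have ls': "f (v(y := False)) = f v" if "f \<in> set ls" "v \<in> asg (insert y V)" for f v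
    using asg_upd_True_eq[of v y V f] ls that by blast
  have "?t \<sim>\<^sub>T\<^sub>H mk m s (insert y V) (\<lambda>v. 1/8 + 3/4 * of_bool (v y) + p v) ls"
  proof (rule th_equiv_mkI[OF wf])
    fix v assume v: "v \<in> asg (insert y V)"
    have "p (v(y := False)) = p v" by (rule asg_upd_True_eq[where f = p, OF v p])
    then show "peval v ?P - (1/8 + 3/4 * of_bool (v y) + p v) \<in> \<int>"
      using V v y by (simp add: restrict_asg_insert)
    show "map (\<lambda>q. peval v q = 1) (?l (take m ls)) = map (\<lambda>f. f v) (take m ls)"
      using V v y by (auto simp: restrict_asg_insert ls' dest: in_set_takeD)
    show "map (\<lambda>q. peval v q = 1) (?l (drop m ls)) = map (\<lambda>f. f v) (drop m ls)"
      using V v y by (auto simp: restrict_asg_insert ls' dest: in_set_dropD)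
  qed
  moreover have "?t \<sim>\<^sub>T\<^sub>H mk m (sqrt 2 * s) V p ls"
  proof (rule th_equiv_step)
    have "y \<notin> pvars (ipoly V p) \<union> Var (set (?l (take m ls)) \<union> set (?l (drop m ls)))"
      using y V by (auto simp: Var_def dest: pvars_ipolyD)
    then have "th_step ?t (SOP (sqrt 2 * s) (insert y V - {y}) (ipoly V p) (?l (take m ls)) (?l (drop m ls)))"
      using wf by (intro th_step.sqrt2[OF refl]) auto
    then show "th_step ?t (mk m (sqrt 2 * s) V p ls)" using y by (simp add: mk_def)
  qed
  ultimately show ?thesis using th_equiv_sym th_equiv_trans by blast
qed

lemma mk_rename:
  assumes V: "finite V" and f: "inj_on f V"
  shows "mk m s V p ls \<sim>\<^sub>T\<^sub>H mk m s (f ` V) (\<lambda>v. p (\<lambda>j. j \<in> V \<and> v (f j)))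
    (map (\<lambda>g v. g (\<lambda>j. j \<in> V \<and> v (f j))) ls)"
proof (rule th_equiv_ident)
  have r: "(\<lambda>j. j \<in> V \<and> f j \<in> f ` V \<and> v (f j)) = (\<lambda>j. j \<in> V \<and> v (f j))" for v
    by auto
  have fV: "finite (f ` V)" using V by simp
  have eq: "ipoly (f ` V) (\<lambda>v. g (\<lambda>j. j \<in> V \<and> v (f j))) = psubst (\<lambda>j. X (f j)) (ipoly V g)"
    for g :: "(nat \<Rightarrow> bool) \<Rightarrow> real"
    using V fV by (intro bpoly_eqI) (simp add: peval_psubst_rename r)
  have eq': "ipoly (f ` V) (\<lambda>v. of_bool (g (\<lambda>j. j \<in> V \<and> v (f j))) :: bit) =
      psubst (\<lambda>j. X (f j)) (ipoly V (\<lambda>v. of_bool (g v)))" for g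
    using V fV by (intro bpoly_eqI) (simp add: peval_psubst_rename r)
  show "sop_ident (mk m s V p ls) (mk m s (f ` V) (\<lambda>v. p (\<lambda>j. j \<in> V \<and> v (f j)))
    (map (\<lambda>g v. g (\<lambda>j. j \<in> V \<and> v (f j))) ls))"
    unfolding sop_ident_def
    by (intro conjI exI[of _ f] wf_mk V fV)
      (auto simp: f mk_def eq eq' take_map drop_map int_coeffs_iff)
qed

text \<open>\<open>HHgen\<close> with \<open>Q = 1\<close> replaces \<open>b\<close> by 1 +
  \<open>Q'\<close>, so \<open>Q'\<close> is taken to be the negation of \<open>q\<close>. The
  variable \<open>a\<close> then survives with an integer phase only and goes away by Elim, which
  accounts for the factor 2.\<close>

lemma mk_HH:
  assumes V: "finite V" and ab: "a \<notin> V" "b \<notin> V" "a \<noteq> b"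
    and q: "\<And>v c d. v \<in> asg V \<Longrightarrow> q (v(a := c, b := d)) = q v"
    and p: "\<And>v. v \<in> asg (insert b V) \<Longrightarrow> p (v(a := True)) = p v"
    and ls: "\<And>f v. f \<in> set ls \<Longrightarrow> v \<in> asg (insert b V) \<Longrightarrow> f (v(a := True)) = f v"
  shows "mk m s (insert a (insert b V))
      (\<lambda>v. of_bool (v a) / 2 * (of_bool (v b) + of_bool (q v)) + p v) ls
    \<sim>\<^sub>T\<^sub>H mk m (2 * s) V (\<lambda>v. p (v(b := q v))) (map (\<lambda>f v. f (v(b := q v))) ls)"
proof -
  let ?W = "insert a (insert b V)" and ?bV = "insert b V"
  let ?l = "map (\<lambda>f. ipoly ?bV (\<lambda>v. of_bool (f v) :: bit))"
  let ?Q = "ipoly V (\<lambda>v. of_bool (\<not> q v) :: bit)"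
  \<comment> \<open>The value of the first term is a/2 (b + (1 - q) + 1), which differs from a/2 (b
    + q) by the integer a (1 - q).\<close>
  let ?P = "Cst (1/2) * X a * (X b * lift 1 + lift ?Q + 1) + ipoly ?bV p"
  let ?t = "SOP s ?W ?P (?l (take m ls)) (?l (drop m ls))"
  let ?u = "remove_var b (sop_subst b (1 + ?Q) ?t)"
  let ?p' = "\<lambda>v. p (v(b := q v))" and ?ls' = "map (\<lambda>f v. f (v(b := q v))) ls"
  have bV: "finite ?bV" "a \<notin> ?bV" using V ab by auto
  have P: "pvars ?P \<subseteq> ?W"
    using V by (intro pvars_subsetI) (simp add: restrict_upd_notin del: fun_upd_apply, simp)
  then have wf: "wf_sop ?t" using V by (auto simp: wf_sop_SOP_iff dest: pvars_ipolyD)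
  have p': "p (v(a := False)) = p v" if "v \<in> asg ?W" for v
    using asg_upd_True_eq[of v a ?bV p] p that by blast
  have ls': "f (v(a := False)) = f v" if "f \<in> set ls" "v \<in> asg ?W" for f v
    using asg_upd_True_eq[of v a ?bV f] ls that by blast
  have restr: "(\<lambda>j. j \<in> V \<and> v j) = v(a := False, b := False)" if "v \<in> asg ?W" for v
    using that ab by (auto simp: asg_def fun_eq_iff)
  have restrB: "(\<lambda>j. (j = b \<or> j \<in> V) \<and> v j) = v(a := False)" if "v \<in> asg ?W" for v
    using that ab by (auto simp: asg_def fun_eq_iff)
  have q': "q (v(a := False, b := False)) = q v" if v: "v \<in> asg ?W" for v
  proof -
    have "v(a := False, b := False) \<in> asg V" using v ab by (auto simp: asg_def)
    from q[OF this, of "v a" "v b"] show ?thesis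
      using ab by (simp add: fun_upd_twist[of a b] fun_upd_idem)
  qed
  have "?t \<sim>\<^sub>T\<^sub>H mk m s ?W (\<lambda>v. of_bool (v a) / 2 * (of_bool (v b) + of_bool (q v)) + p v) ls"
  proof (rule th_equiv_mkI[OF wf])
    fix v assume v: "v \<in> asg ?W"
    show "peval v ?P - (of_bool (v a) / 2 * (of_bool (v b) + of_bool (q v)) + p v) \<in> \<int>"
      using v p'[OF v] q'[OF v] V bV by (simp add: restrB restr)
    show "map (\<lambda>q. peval v q = 1) (?l (take m ls)) = map (\<lambda>f. f v) (take m ls)"
      using bV v by (auto simp: restrB ls' dest: in_set_takeD)
    show "map (\<lambda>q. peval v q = 1) (?l (drop m ls)) = map (\<lambda>f. f v) (drop m ls)"
      using bV v by (auto simp: restrB ls' dest: in_set_dropD)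
  qed
  then have "mk m s ?W (\<lambda>v. of_bool (v a) / 2 * (of_bool (v b) + of_bool (q v)) + p v) ls \<sim>\<^sub>T\<^sub>H ?t"
    by (rule th_equiv_sym)
  also have "?t \<sim>\<^sub>T\<^sub>H ?u"
    by (rule th_equiv_step, rule th_step.HHgen[OF refl wf])
      (use V ab in \<open>auto simp: Var_def pvars_def[of 1] zero_mono_def dest: pvars_ipolyD\<close>)
  also have "?u \<sim>\<^sub>T\<^sub>H mk m s (insert a V) ?p' ?ls'"
  proof -
    have u: "?u = SOP s (insert a V) (psubst (X(b := lift (1 + ?Q))) ?P)
        (map (psubst (X(b := 1 + ?Q))) (?l (take m ls))) (map (psubst (X(b := 1 + ?Q))) (?l (drop m ls)))"
      using ab by (auto simp: remove_var_def sop_subst_def)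
    have "pvars (1 + ?Q) \<subseteq> V"
      using V by (intro pvars_subsetI) (simp add: restrict_upd_notin del: fun_upd_apply)
    then have wfu: "wf_sop ?u"
      using ab by (intro wf_remove_var_sop_subst[OF wf]) auto
    have upd: "v(b := q v) \<in> asg ?W" if "v \<in> asg (insert a V)" for v
      using that by (auto simp: asg_def)
    have Q: "(peval v (1 + ?Q) = 1) = q v" if v: "v \<in> asg (insert a V)" for v
    proof -
      have v': "v \<in> asg ?W" using v by (rule asg_mono) auto
      show ?thesis using q'[OF v'] V by (simp add: restr[OF v'])
    qed
    show ?thesis
      unfolding u
    proof (rule th_equiv_mkI[OF wfu[unfolded u]])
      fix v assume v: "v \<in> asg (insert a V)"
      have v': "v \<in> asg ?W" using v by (rule asg_mono) auto
      have vb: "v(b := False) = v" using v ab by (intro fun_upd_idem) (auto simp: asg_def)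
      define w where "w = v(b := q v)"
      have w: "w \<in> asg ?W" unfolding w_def by (rule upd[OF v])
      have "q w = q v"
        using q'[OF w] q'[OF v'] ab by (simp add: w_def fun_upd_twist[of a b] vb)
      then have "q w = w b" by (simp add: w_def)
      \<comment> \<open>With b = q the first term of the phase is a itself, an integer.\<close>
      then have "peval w ?P - p w \<in> \<int>"
        using p'[OF w] q'[OF w] V bV by (simp add: restrB[OF w] restr[OF w])
      then show "peval v (psubst (X(b := lift (1 + ?Q))) ?P) - ?p' v \<in> \<int>"
        unfolding peval_psubst_upd_lift Q[OF v] w_def .
      have ls_w: "f (\<lambda>j. j \<in> ?bV \<and> w j) = f w" if "f \<in> set ls" for f
        using restrB[OF w] ls'[OF that w] by simp
      show "map (\<lambda>q. peval v q = 1) (map (psubst (X(b := 1 + ?Q))) (?l (take m ls))) =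
          map (\<lambda>f. f v) (take m ?ls')"
        unfolding map_map o_def peval_psubst_upd_bit Q[OF v] take_map w_def[symmetric]
        using bV ls_w by (auto dest: in_set_takeD)
      show "map (\<lambda>q. peval v q = 1) (map (psubst (X(b := 1 + ?Q))) (?l (drop m ls))) =
          map (\<lambda>f. f v) (drop m ?ls')"
        unfolding map_map o_def peval_psubst_upd_bit Q[OF v] drop_map w_def[symmetric]
        using bV ls_w by (auto dest: in_set_dropD)
    qed
  qed
  also have "mk m s (insert a V) ?p' ?ls' \<sim>\<^sub>T\<^sub>H mk m (2 * s) V ?p' ?ls'"
  proof (rule mk_Elim[OF V ab(1)])
    fix v assume v: "v \<in> asg V"
    have q: "q (v(a := True)) = q v" using q[OF v, of True "v b"] by (simp add: fun_upd_twist[OF ab(3)])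
    have v': "v(b := q v) \<in> asg ?bV" using v by (rule asg_upd_insert)
    show "?p' (v(a := True)) = ?p' v"
      using p[OF v'] ab by (simp add: q fun_upd_twist)
    fix f assume "f \<in> set ?ls'"
    then obtain g where g: "g \<in> set ls" and f: "f = (\<lambda>v. g (v(b := q v)))" by auto
    show "f (v(a := True)) = f v"
      using ls[OF g v'] ab by (simp add: f q fun_upd_twist)
  qed
  finally show ?thesis .
qed


section \<open>Moves on the sum over internal variables\<close>

text \<open>Variables below \<open>N\<close> are the boundary, the first \<open>m\<close> being kets
  and the others bras; the internal variables are the elements of \<open>V\<close> that are at least
  \<open>N\<close>. For fixed \<open>V\<close> and scalar all information sits in
  \<open>p\<close>.\<close>

definition nf :: "nat \<Rightarrow> nat \<Rightarrow> real \<Rightarrow> nat set \<Rightarrow> ((nat \<Rightarrow> bool) \<Rightarrow> real) \<Rightarrow> sop"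
  where "nf m N s V p = mk m s V p (map (\<lambda>i v. v i) [0..<N])"

lemma nf_cong:
  assumes "finite V" "\<And>v. v \<in> asg V \<Longrightarrow> p v - p' v \<in> \<int>"
  shows "nf m N s V p \<sim>\<^sub>T\<^sub>H nf m N s V p'"
  unfolding nf_def using assms by (intro mk_cong) auto

lemma nf_Elim:
  assumes "finite V" "y \<notin> V" "N \<le> y" "\<And>v. v \<in> asg V \<Longrightarrow> p (v(y := True)) = p v"
  shows "nf m N s (insert y V) p \<sim>\<^sub>T\<^sub>H nf m N (2 * s) V p"
  unfolding nf_def using assms by (intro mk_Elim) auto

lemma nf_sqrt2:
  assumes "finite V" "y \<notin> V" "N \<le> y" "\<And>v. v \<in> asg V \<Longrightarrow> p (v(y := True)) = p v"
  shows "nf m N s (insert y V) (\<lambda>v. 1/8 + 3/4 * of_bool (v y) + p v) \<sim>\<^sub>T\<^sub>H nf m N (sqrt 2 * s) V p"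
  unfolding nf_def using assms by (intro mk_sqrt2) auto

lemma nf_HH:
  assumes "finite V" "a \<notin> V" "b \<notin> V" "a \<noteq> b" "N \<le> a" "N \<le> b"
    and "\<And>v c d. v \<in> asg V \<Longrightarrow> q (v(a := c, b := d)) = q v"
    and "\<And>v. v \<in> asg (insert b V) \<Longrightarrow> p (v(a := True)) = p v"
  shows "nf m N s (insert a (insert b V))
      (\<lambda>v. of_bool (v a) / 2 * (of_bool (v b) + of_bool (q v)) + p v)
    \<sim>\<^sub>T\<^sub>H nf m N (2 * s) V (\<lambda>v. p (v(b := q v)))"
proof -
  have "map (\<lambda>f v. f (v(b := q v))) (map (\<lambda>i v. v i) [0..<N]) = map (\<lambda>i v. v i) [0..<N]"
    using assms(6) by auto
  moreover have "mk m s (insert a (insert b V))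
      (\<lambda>v. of_bool (v a) / 2 * (of_bool (v b) + of_bool (q v)) + p v) (map (\<lambda>i v. v i) [0..<N])
    \<sim>\<^sub>T\<^sub>H mk m (2 * s) V (\<lambda>v. p (v(b := q v)))
      (map (\<lambda>f v. f (v(b := q v))) (map (\<lambda>i v. v i) [0..<N]))"
    using assms by (intro mk_HH) auto
  ultimately show ?thesis
    unfolding nf_def by (simp only:)
qed

lemma obtain_fresh:
  fixes N :: nat
  assumes "finite V"
  obtains z where "z \<notin> V" "N \<le> z"
proof -
  have "finite (V \<union> {..<N})" using assms by simp
  then obtain z where "z \<notin> V \<union> {..<N}" using ex_new_if_finite[OF infinite_UNIV_nat] by blast
  then show ?thesis using that by auto
qed

text \<open>Introduce \<open>z = v i \<noteq> g v\<close> by HH and then eliminate \<open>i\<close>, which the same phase expresses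
  as \<open>z \<noteq> g v\<close>. The result does not depend on \<open>g\<close>.\<close>

lemma nf_transvection_aux:
  assumes V: "finite V" and i: "i \<in> V" "N \<le> i" and z: "z \<notin> V" "N \<le> z"
    and p: "\<And>v y c. y \<notin> V \<Longrightarrow> p (v(y := c)) = p v"
    and g: "\<And>v y c. y \<notin> V - {i} \<Longrightarrow> g (v(y := c)) = g v"
  shows "nf m N s V (\<lambda>v. p (v(i := (v i \<noteq> g v)))) \<sim>\<^sub>T\<^sub>H
    nf m N s (insert z (V - {i})) (\<lambda>v. p (v(i := v z)))"
proof -
  obtain a where a: "a \<notin> insert z V" "N \<le> a" using obtain_fresh[of "insert z V"] V by auto
  let ?V' = "insert z (V - {i})"
  \<comment> \<open>The phase \<open>p\<close> reads the value of \<open>i\<close> off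
    \<open>z\<close>, so it no longer depends on \<open>i\<close> and either variable can be
    eliminated. The half is restored by the factor 2 of HH.\<close>
  let ?M = "nf m N (s / 2) (insert a (insert z V))
    (\<lambda>v. of_bool (v a) / 2 * (of_bool (v z) + of_bool (v i \<noteq> g v)) + p (v(i := v z)))"
  have ne: "z \<noteq> i" "a \<noteq> i" "a \<noteq> z" using a i z by auto
  have pa: "p (v(a := c, i := d)) = p (v(i := d))" for v c d
    using p[of a "v(i := d)" c] a ne by (simp add: fun_upd_twist)
  have pz: "p (v(z := c, i := d)) = p (v(i := d))" for v c d
    using p[of z "v(i := d)" c] z ne by (simp add: fun_upd_twist)
  have "?M \<sim>\<^sub>T\<^sub>H nf m N (2 * (s / 2)) V (\<lambda>v. p ((v(z := (v i \<noteq> g v)))(i := (v(z := (v i \<noteq> g v))) z)))"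
    using a z V i ne by (intro nf_HH) (auto simp: g pa)
  then have 1: "?M \<sim>\<^sub>T\<^sub>H nf m N s V (\<lambda>v. p (v(i := (v i \<noteq> g v))))"
    by (simp add: pz)
  have eq: "insert a (insert z V) = insert a (insert i ?V')" using i by auto
  have "?M \<sim>\<^sub>T\<^sub>H nf m N (s / 2) (insert a (insert i ?V'))
    (\<lambda>v. of_bool (v a) / 2 * (of_bool (v i) + of_bool (v z \<noteq> g v)) + p (v(i := v z)))"
    unfolding eq using V by (intro nf_cong) auto
  also have "\<dots> \<sim>\<^sub>T\<^sub>H nf m N (2 * (s / 2)) ?V' (\<lambda>v. p ((v(i := (v z \<noteq> g v)))(i := (v(i := (v z \<noteq> g v))) z)))"
    using a z V i ne by (intro nf_HH) (auto simp: g pa)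
  finally have "?M \<sim>\<^sub>T\<^sub>H nf m N s ?V' (\<lambda>v. p (v(i := v z)))"
    using ne by simp
  with 1 show ?thesis using th_equiv_sym th_equiv_trans by blast
qed

lemma nf_restrict:
  "finite V \<Longrightarrow> nf m N s V p \<sim>\<^sub>T\<^sub>H nf m N s V (\<lambda>v. p (\<lambda>j. j \<in> V \<and> v j))"
  by (rule nf_cong) (auto simp: restrict_asg)

text \<open>Both \<open>g\<close> and the constant \<open>False\<close> lead to the same morphism,
  in which \<open>z\<close> has taken the place of \<open>i\<close>; with \<open>False\<close> the
  starting point is \<open>p\<close> itself.\<close>

lemma nf_transvection:
  assumes V: "finite V" and i: "i \<in> V" "N \<le> i"
    and g: "\<And>v y c. y \<notin> V - {i} \<Longrightarrow> g (v(y := c)) = g v"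
  shows "nf m N s V p \<sim>\<^sub>T\<^sub>H nf m N s V (\<lambda>v. p (v(i := (v i \<noteq> g v))))"
proof -
  obtain z where z: "z \<notin> V" "N \<le> z" using obtain_fresh V by blast
  define p' where "p' v = p (\<lambda>j. j \<in> V \<and> v j)" for v
  have p': "p' (v(y := c)) = p' v" if "y \<notin> V" for v y c
    using that unfolding p'_def by (simp only: restrict_upd_notin not_False_eq_True)
  have p'p: "p' v = p v" if "v \<in> asg V" for v
    using that by (simp add: p'_def restrict_asg)
  have aux: "nf m N s V (\<lambda>v. p' (v(i := (v i \<noteq> g v)))) \<sim>\<^sub>T\<^sub>H
    nf m N s (insert z (V - {i})) (\<lambda>v. p' (v(i := v z)))"
    if "\<And>v y c. y \<notin> V - {i} \<Longrightarrow> g (v(y := c)) = g v" for g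
    using nf_transvection_aux[OF V i z p' that] by blast
  have "nf m N s V p \<sim>\<^sub>T\<^sub>H nf m N s V (\<lambda>v. p' (v(i := (v i \<noteq> False))))"
    using V p'p by (intro nf_cong) auto
  also have "\<dots> \<sim>\<^sub>T\<^sub>H nf m N s (insert z (V - {i})) (\<lambda>v. p' (v(i := v z)))"
    by (rule aux) simp
  also have "\<dots> \<sim>\<^sub>T\<^sub>H nf m N s V (\<lambda>v. p' (v(i := (v i \<noteq> g v))))"
    by (rule th_equiv_sym, rule aux, rule g)
  also have "\<dots> \<sim>\<^sub>T\<^sub>H nf m N s V (\<lambda>v. p (v(i := (v i \<noteq> g v))))"
  proof (rule nf_cong[OF V])
    fix v assume "v \<in> asg V"
    then have "v(i := (v i \<noteq> g v)) \<in> asg V" using i by (auto simp: asg_def)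
    then show "p' (v(i := (v i \<noteq> g v))) - p (v(i := (v i \<noteq> g v))) \<in> \<int>" by (simp add: p'p)
  qed
  finally show ?thesis .
qed

text \<open>The control \<open>g\<close> is the indicator of the line through \<open>v\<close> in
  direction \<open>i\<close>. That line consists of \<open>v\<close> and \<open>w\<close>, so
  flipping \<open>i\<close> under \<open>g\<close> exchanges these two and fixes everything else.
  Clearing \<open>i\<close> before the comparison keeps \<open>g\<close> independent of
  \<open>i\<close>.\<close>

lemma nf_transpose_edge:
  assumes V: "finite V" and i: "i \<in> V" "N \<le> i" and v: "v \<in> asg V" and w: "w = v(i := (\<not> v i))"
  shows "nf m N s V p \<sim>\<^sub>T\<^sub>H nf m N s V (p(v := p w, w := p v))"
proof -
  define g where "g u = ((\<lambda>j. j \<in> V - {i} \<and> u j) = v(i := False))" for u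
  have g: "g (u(y := c)) = g u" if "y \<notin> V - {i}" for u y c
    using that unfolding g_def by (simp only: restrict_upd_notin not_False_eq_True)
  have "nf m N s V p \<sim>\<^sub>T\<^sub>H nf m N s V (\<lambda>u. p (u(i := (u i \<noteq> g u))))"
    by (rule nf_transvection[OF V i]) (rule g)
  also have "\<dots> \<sim>\<^sub>T\<^sub>H nf m N s V (p(v := p w, w := p v))"
  proof (rule nf_cong[OF V])
    fix u assume u: "u \<in> asg V"
    have gu: "g u \<longleftrightarrow> u(i := False) = v(i := False)"
    proof -
      have "(\<lambda>j. j \<in> V - {i} \<and> u j) = u(i := False)" using u by (auto simp: asg_def fun_eq_iff)
      then show ?thesis by (simp add: g_def)
    qed
    show "p (u(i := (u i \<noteq> g u))) - (p(v := p w, w := p v)) u \<in> \<int>"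
    proof (cases "g u")
      case False
      then have "u \<noteq> v" "u \<noteq> w" using gu w by auto
      then show ?thesis using False by simp
    next
      case True
      then have e: "u(i := False) = v(i := False)" using gu by simp
      have eq: "u(i := c) = v(i := c)" for c
        using arg_cong[OF e, of "\<lambda>f. f(i := c)"] by simp
      have vw: "v \<noteq> w" using w by (metis fun_upd_same)
      consider "u i = v i" | "u i = (\<not> v i)" by blast
      then show ?thesis
      proof cases
        case 1
        then have "u = v" using eq[of "v i"] by (simp add: fun_upd_idem)
        then show ?thesis using True vw by (simp add: w)
      next
        case 2
        then have "u = w" using eq[of "\<not> v i"] w by (simp add: fun_upd_idem)
        moreover have "u(i := (u i \<noteq> g u)) = v" using True 2 by (simp add: eq)
        ultimately show ?thesis using vw by simp
      qed
    qed
  qed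
  finally show ?thesis .
qed

text \<open>Induction on the Hamming distance: for a neighbour v' of v that is closer to w, (v w) =
  (v v') (v' w) (v v'). All coordinates that are flipped are internal, since \<open>v\<close> and
  \<open>w\<close> agree on the boundary.\<close>

lemma nf_transpose:
  assumes V: "finite V" and v: "v \<in> asg V" and w: "w \<in> asg V" and "\<And>j. j < N \<Longrightarrow> v j = w j"
  shows "nf m N s V p \<sim>\<^sub>T\<^sub>H nf m N s V (p(v := p w, w := p v))"
  using v assms(4)
proof (induction "card {j. v j \<noteq> w j}" arbitrary: v p rule: less_induct)
  case less
  have sub: "{j. v j \<noteq> w j} \<subseteq> V" using less.prems w by (auto simp: asg_def)
  show ?case
  proof (cases "v = w")
    case True
    then show ?thesis by simp
  next
    case False
    then obtain i where i: "v i \<noteq> w i" by auto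
    then have iV: "i \<in> V" "N \<le> i" using sub less.prems(2)[of i] by (auto simp: not_less[symmetric])
    define v' where "v' = v(i := (\<not> v i))"
    have v': "v' \<in> asg V" using less.prems iV by (auto simp: v'_def asg_def)
    have vi: "v' i = w i" using i by (auto simp: v'_def)
    have "v \<noteq> v'" using vi i by metis
    have edge: "nf m N s V p \<sim>\<^sub>T\<^sub>H nf m N s V (p(v := p v', v' := p v))" for p
      by (rule nf_transpose_edge[OF V iV less.prems(1) v'_def])
    show ?thesis
    proof (cases "v' = w")
      case True
      then show ?thesis using edge by simp
    next
      case False
      have "{j. v' j \<noteq> w j} \<subset> {j. v j \<noteq> w j}" using i vi by (auto simp: v'_def)
      then have "card {j. v' j \<noteq> w j} < card {j. v j \<noteq> w j}"
        using finite_subset[OF sub V] by (rule psubset_card_mono[rotated])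
      then have IH: "nf m N s V p \<sim>\<^sub>T\<^sub>H nf m N s V (p(v' := p w, w := p v'))" for p
        using less.prems iV v' by (intro less.hyps) (auto simp: v'_def)
      let ?p1 = "p(v := p v', v' := p v)"
      let ?p2 = "?p1(v' := ?p1 w, w := ?p1 v')"
      have "nf m N s V p \<sim>\<^sub>T\<^sub>H nf m N s V ?p1" by (rule edge)
      also have "\<dots> \<sim>\<^sub>T\<^sub>H nf m N s V ?p2" by (rule IH)
      also have "\<dots> \<sim>\<^sub>T\<^sub>H nf m N s V (?p2(v := ?p2 v', v' := ?p2 v))" by (rule edge)
      also have "?p2(v := ?p2 v', v' := ?p2 v) = p(v := p w, w := p v)"
        using \<open>v \<noteq> v'\<close> \<open>v \<noteq> w\<close> \<open>v' \<noteq> w\<close> by (intro ext) simp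
      finally show ?thesis .
    qed
  qed
qed

text \<open>A path variable \<open>y\<close> with phase \<open>y d / 2\<close> restricts the sum to \<open>\<not> d\<close>, where \<open>d C\<close> vanishes.\<close>

lemma nf_zero_branch:
  assumes V: "finite V" and y: "y \<notin> V" "N \<le> y"
    and p: "\<And>v x c. x \<notin> V \<Longrightarrow> p (v(x := c)) = p v"
    and d: "\<And>v x c. x \<notin> V \<Longrightarrow> d (v(x := c)) = d v"
  shows "nf m N s (insert y V) (\<lambda>v. p v + of_bool (v y) / 2 * of_bool (d v) + of_bool (d v) * C)
    \<sim>\<^sub>T\<^sub>H nf m N s (insert y V) (\<lambda>v. p v + of_bool (v y) / 2 * of_bool (d v))"
proof -
  obtain z where z: "z \<notin> insert y V" "N \<le> z" using obtain_fresh[of "insert y V"] V by auto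
  obtain a where a: "a \<notin> insert z (insert y V)" "N \<le> a"
    using obtain_fresh[of "insert z (insert y V)"] V by auto
  have "nf m N s (insert y V) (\<lambda>v. p v + of_bool (v y) / 2 * of_bool (d v) + of_bool (d v) * C)
    \<sim>\<^sub>T\<^sub>H nf m N s (insert a V) (\<lambda>v. p v + of_bool (v a) / 2 * of_bool (d v))" for C
  proof -
    \<comment> \<open>Here \<open>z\<close> stands for \<open>d\<close>. Eliminating
      \<open>a\<close> substitutes \<open>d\<close> for \<open>z\<close> and gives the left-hand
      side. Eliminating \<open>y\<close> instead substitutes \<open>False\<close> for
      \<open>z\<close>, which erases \<open>C\<close>; the result is the same for every
      \<open>C\<close>, in particular for 0.\<close>
    let ?M = "nf m N (s / 2) (insert a (insert z (insert y V)))
      (\<lambda>v. of_bool (v a) / 2 * (of_bool (v z) + of_bool (d v)) +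
        (p v + of_bool (v y) / 2 * of_bool (v z) + of_bool (v z) * C))"
    have "?M \<sim>\<^sub>T\<^sub>H nf m N (2 * (s / 2)) (insert y V)
      (\<lambda>v. p (v(z := d v)) + of_bool ((v(z := d v)) y) / 2 * of_bool ((v(z := d v)) z)
        + of_bool ((v(z := d v)) z) * C)"
      using a z y V by (intro nf_HH) (auto simp: p d)
    moreover have "z \<noteq> y" using z by auto
    ultimately have 1: "?M \<sim>\<^sub>T\<^sub>H nf m N s (insert y V)
      (\<lambda>v. p v + of_bool (v y) / 2 * of_bool (d v) + of_bool (d v) * C)"
      using z by (simp add: p)
    have eq: "insert a (insert z (insert y V)) = insert y (insert z (insert a V))" by auto
    have "?M \<sim>\<^sub>T\<^sub>H nf m N (s / 2) (insert y (insert z (insert a V)))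
      (\<lambda>v. of_bool (v y) / 2 * (of_bool (v z) + of_bool False) +
        (p v + of_bool (v z) * C + of_bool (v a) / 2 * (of_bool (v z) + of_bool (d v))))"
      unfolding eq using V by (intro nf_cong) (auto simp: algebra_simps)
    also have "\<dots> \<sim>\<^sub>T\<^sub>H nf m N (2 * (s / 2)) (insert a V)
      (\<lambda>v. p (v(z := False)) + of_bool ((v(z := False)) z) * C
        + of_bool ((v(z := False)) a) / 2 * (of_bool ((v(z := False)) z) + of_bool (d (v(z := False)))))"
      using a z y V by (intro nf_HH) (auto simp: p d)
    finally have "?M \<sim>\<^sub>T\<^sub>H nf m N s (insert a V) (\<lambda>v. p v + of_bool (v a) / 2 * of_bool (d v))"
      using a z by (simp add: p d)
    with 1 show ?thesis using th_equiv_sym th_equiv_trans by blast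
  qed
  from th_equiv_trans[OF this[of C] th_equiv_sym[OF this[of 0]]] show ?thesis
    by (simp only: mult_zero_right add_0_right)
qed

text \<open>What counts is that the right-hand side no longer mentions \<open>p v\<close> and
  \<open>p w\<close>. With a dummy \<open>y\<close>, the phases at v, w are c, c + 1/2 for either
  value of \<open>y\<close>, where c = \<open>p v\<close>. Exchanging the entries (w, y = 0) and (v,
  y = 1) yields c, c for y = 0 and c + 1/2, c + 1/2 for y = 1, that is c + y/2 on the whole line.
  The constant c is then dropped as the content of a zero branch.\<close>

lemma nf_cancel_edge_aux:
  assumes V: "finite V" and i: "i \<in> V" "N \<le> i" and y: "y \<notin> V" "N \<le> y"
    and v: "v \<in> asg V" "\<not> v i" and w: "w = v(i := True)" and pw: "p w - (p v + 1/2) \<in> \<int>"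
  shows "nf m N s V p \<sim>\<^sub>T\<^sub>H nf m N (s / 2) (insert y V)
    (\<lambda>u. (if (\<lambda>j. j \<in> V - {i} \<and> u j) = v then 0 else p (\<lambda>j. j \<in> V \<and> u j))
      + of_bool (u y) / 2 * of_bool ((\<lambda>j. j \<in> V - {i} \<and> u j) = v))"
proof -
  define d where "d u \<longleftrightarrow> (\<lambda>j. j \<in> V - {i} \<and> u j) = v" for u
  define p1 where "p1 u = p (\<lambda>j. j \<in> V \<and> u j)" for u
  define r where "r u = (if d u then 0 else p1 u)" for u
  define B where "B = v(y := True)"
  have yi: "y \<noteq> i" using i y by auto
  have vy: "\<not> v y" using v y by (auto simp: asg_def)
  have wV: "w \<in> asg V" using v i by (auto simp: w asg_def)
  have d_upd: "d (u(x := c)) = d u" if "x \<notin> V" for u x c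
    unfolding d_def using that by (subst restrict_upd_notin) auto
  have p1_upd: "p1 (u(x := c)) = p1 u" if "x \<notin> V" for u x c
    unfolding p1_def using that by (simp only: restrict_upd_notin not_False_eq_True)
  have p1v: "p1 v = p v" "p1 w = p w" "p1 B = p v"
    using v wV p1_upd[OF y(1), of v True] by (simp_all add: p1_def restrict_asg B_def)
  have dvw: "d w" "d B"
    using v y vy by (auto simp: d_def B_def w asg_def fun_eq_iff)
  have "nf m N s V p \<sim>\<^sub>T\<^sub>H nf m N s V p1"
    unfolding p1_def using V by (rule nf_restrict)
  also have "\<dots> \<sim>\<^sub>T\<^sub>H nf m N (s / 2) (insert y V) p1"
    using nf_Elim[OF V y, of p1 m "s / 2"] p1_upd[OF y(1)] by (auto intro: th_equiv_sym)
  also have "\<dots> \<sim>\<^sub>T\<^sub>H nf m N (s / 2) (insert y V) (p1(w := p1 B, B := p1 w))"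
  proof (rule nf_transpose)
    show "w j = B j" if "j < N" for j using that i y by (auto simp: w B_def)
  qed (use V v wV in \<open>auto simp: B_def asg_def\<close>)
  also have "\<dots> \<sim>\<^sub>T\<^sub>H nf m N (s / 2) (insert y V)
      (\<lambda>u. r u + of_bool (u y) / 2 * of_bool (d u) + of_bool (d u) * p v)"
  proof (rule nf_cong)
    fix u assume u: "u \<in> asg (insert y V)"
    show "(p1(w := p1 B, B := p1 w)) u -
        (r u + of_bool (u y) / 2 * of_bool (d u) + of_bool (d u) * p v) \<in> \<int>"
    proof (cases "d u")
      case False
      then have "u \<noteq> w" "u \<noteq> B" using dvw by auto
      then show ?thesis using False by (simp add: r_def)
    next
      case True
      have u_eq: "u = v(i := u i, y := u y)"
      proof
        fix j
        have "(j \<in> V - {i} \<and> u j) = v j" using True by (auto simp: d_def fun_eq_iff)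
        then show "u j = (v(i := u i, y := u y)) j" using u by (auto simp: asg_def)
      qed
      have wB: "w \<noteq> B" using yi w v by (auto simp: B_def fun_eq_iff)
      have corners: "v(i := False, y := False) = v" "v(i := True, y := False) = w"
          "v(i := False, y := True) = B" "v(i := True, y := True) = w(y := True)"
        using v vy yi by (simp_all add: w B_def fun_upd_idem)
      have u_eq': "u = v(i := a, y := b)" if "u i = a" "u y = b" for a b using u_eq that by simp
      consider "u = v" "\<not> u y" | "u = w" "\<not> u y" | "u = B" "u y" | "u = w(y := True)" "u y"
        using u_eq'[of False False] u_eq'[of True False] u_eq'[of False True] u_eq'[of True True]
        unfolding corners by blast
      then show ?thesis
      proof cases
        case 1
        then have "u \<noteq> w" "u \<noteq> B" using v vy by (auto simp: w B_def fun_eq_iff)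
        then show ?thesis using 1 True by (simp add: r_def p1v)
      next
        case 2
        then show ?thesis using True wB by (simp add: r_def p1v)
      next
        case 3
        then show ?thesis using True pw by (simp add: r_def p1v algebra_simps)
      next
        case 4
        have "(w(y := True)) i \<noteq> B i" using v yi by (simp add: w B_def)
        then have "u \<noteq> B" using 4 by auto
        moreover have "\<not> w y" using yi vy by (simp add: w)
        then have "u \<noteq> w" using 4(2) by auto
        moreover have "p1 u = p w" using 4 p1_upd[OF y(1), of w True] p1v by simp
        ultimately show ?thesis using 4 True pw by (simp add: r_def algebra_simps)
      qed
    qed
  qed (use V in simp)
  also have "\<dots> \<sim>\<^sub>T\<^sub>H nf m N (s / 2) (insert y V) (\<lambda>u. r u + of_bool (u y) / 2 * of_bool (d u))"
    using V y by (rule nf_zero_branch) (simp_all only: r_def d_upd p1_upd not_False_eq_True)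
  finally show ?thesis by (simp only: r_def d_def p1_def)
qed

text \<open>The morphism that has forgotten the values at \<open>v\<close> and \<open>w\<close> can
  be reached from the old pair and from the new one.\<close>

lemma nf_cancel_edge:
  assumes V: "finite V" and i: "i \<in> V" "N \<le> i"
    and v: "v \<in> asg V" "\<not> v i" and w: "w = v(i := True)" and pw: "p w - (p v + 1/2) \<in> \<int>"
  shows "nf m N s V p \<sim>\<^sub>T\<^sub>H nf m N s V (p(v := c, w := c + 1/2))"
proof -
  obtain y where y: "y \<notin> V" "N \<le> y" using obtain_fresh V by blast
  let ?d = "\<lambda>u. (\<lambda>j. j \<in> V - {i} \<and> u j) = v"
  let ?R = "\<lambda>p :: _ \<Rightarrow> real. \<lambda>u. (if ?d u then 0 else p (\<lambda>j. j \<in> V \<and> u j)) + of_bool (u y) / 2 * of_bool (?d u)"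
  let ?p' = "p(v := c, w := c + 1/2)"
  have vw: "v \<noteq> w" using v w by (metis fun_upd_same)
  have R: "?R p = ?R ?p'"
  proof
    fix u
    have "?d u" if "(\<lambda>j. j \<in> V \<and> u j) \<in> {v, w}"
    proof -
      have "(\<lambda>j. j \<in> V - {i} \<and> u j) = (\<lambda>j. j \<in> V \<and> u j)(i := False)"
        by (auto simp: fun_eq_iff)
      also have "\<dots> = v" using that v by (auto simp: w intro: fun_upd_idem)
      finally show ?thesis .
    qed
    then show "?R p u = ?R ?p' u" by auto
  qed
  have "nf m N s V p \<sim>\<^sub>T\<^sub>H nf m N (s / 2) (insert y V) (?R p)"
    by (rule nf_cancel_edge_aux[OF V i y v w pw])
  also have "nf m N (s / 2) (insert y V) (?R p) = nf m N (s / 2) (insert y V) (?R ?p')"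
    by (rule arg_cong[OF R])
  also have "\<dots> \<sim>\<^sub>T\<^sub>H nf m N s V ?p'"
    by (rule th_equiv_sym, rule nf_cancel_edge_aux[OF V i y v w]) (use vw in simp)
  finally show ?thesis .
qed

lemma half_notin_Ints: "(1/2 :: real) \<notin> \<int>"
proof
  assume "(1/2 :: real) \<in> \<int>"
  then obtain z where "(1/2 :: real) = of_int z" by (rule Ints_cases)
  then have "of_int (2 * z) = (of_int 1 :: real)" by simp
  then have "2 * z = 1" by (simp only: of_int_eq_iff)
  then show False by presburger
qed

text \<open>A transposition brings the entry of \<open>w\<close> to a neighbour of \<open>v\<close>,
  the pair is overwritten along that edge, and the same transposition brings it back.\<close>

lemma nf_cancel:
  assumes V: "finite V" and v: "v \<in> asg V" and w: "w \<in> asg V" and agree: "\<And>j. j < N \<Longrightarrow> v j = w j"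
    and pw: "p w - (p v + 1/2) \<in> \<int>"
  shows "nf m N s V p \<sim>\<^sub>T\<^sub>H nf m N s V (p(v := c, w := c + 1/2))"
proof -
  have *: "nf m N s V p \<sim>\<^sub>T\<^sub>H nf m N s V (p(v := c, w := c + 1/2))"
    if v: "v \<in> asg V" and w: "w \<in> asg V" and agree: "\<And>j. j < N \<Longrightarrow> v j = w j"
    and pw: "p w - (p v + 1/2) \<in> \<int>" and i: "\<not> v i" "w i" for v w i c
  proof -
    have iV: "i \<in> V" "N \<le> i" using w i agree[of i] by (auto simp: asg_def not_less[symmetric])
    define w' where "w' = v(i := True)"
    have w': "w' \<in> asg V" using v iV by (auto simp: w'_def asg_def)
    have ne: "v \<noteq> w'" "v \<noteq> w" using i by (auto simp: w'_def fun_eq_iff)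
    show ?thesis
    proof (cases "w' = w")
      case True
      then show ?thesis using nf_cancel_edge[OF V iV v i(1) w'_def, of p] pw by simp
    next
      case False
      have agree': "\<And>j. j < N \<Longrightarrow> w j = w' j" using agree iV by (auto simp: w'_def)
      let ?p1 = "p(w := p w', w' := p w)"
      let ?p2 = "?p1(v := c, w' := c + 1/2)"
      have "nf m N s V p \<sim>\<^sub>T\<^sub>H nf m N s V ?p1"
        by (rule nf_transpose[OF V w w' agree'])
      also have "\<dots> \<sim>\<^sub>T\<^sub>H nf m N s V ?p2"
        using False ne pw by (intro nf_cancel_edge[OF V iV v i(1) w'_def]) auto
      also have "\<dots> \<sim>\<^sub>T\<^sub>H nf m N s V (?p2(w := ?p2 w', w' := ?p2 w))"
        by (rule nf_transpose[OF V w w' agree'])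
      also have "?p2(w := ?p2 w', w' := ?p2 w) = p(v := c, w := c + 1/2)"
        using False ne by (intro ext) simp
      finally show ?thesis .
    qed
  qed
  have ne: "v \<noteq> w"
  proof
    assume "v = w"
    then have "(1/2 :: real) \<in> \<int>" using Ints_minus[OF pw] by simp
    then show False by (simp add: half_notin_Ints)
  qed
  then obtain i where "v i \<noteq> w i" by auto
  then consider "\<not> v i" "w i" | "\<not> w i" "v i" by auto
  then show ?thesis
  proof cases
    case 1
    then show ?thesis using * v w agree pw by blast
  next
    case 2
    have "p v - (p w + 1/2) = - (p w - (p v + 1/2)) - 1" by simp
    also have "\<dots> \<in> \<int>" by (rule Ints_diff[OF Ints_minus[OF pw] Ints_1])
    \<comment> \<open>With the roles of \<open>v\<close> and \<open>w\<close> exchanged, the new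
      value at \<open>w\<close> is c + 1/2 and its opposite at \<open>v\<close> is c + 1, which is c
      modulo \<int>.\<close>
    finally have "nf m N s V p \<sim>\<^sub>T\<^sub>H nf m N s V (p(w := c + 1/2, v := c + 1/2 + 1/2))"
      using * [OF w v _ _ 2, of "c + 1/2"] agree by metis
    also have "\<dots> \<sim>\<^sub>T\<^sub>H nf m N s V (p(v := c, w := c + 1/2))"
    proof (rule nf_cong[OF V])
      fix u
      show "(p(w := c + 1/2, v := c + 1/2 + 1/2)) u - (p(v := c, w := c + 1/2)) u \<in> \<int>"
        using ne by (cases "u = v"; cases "u = w") simp_all
    qed
    finally show ?thesis .
  qed
qed


section \<open>Linear independence of roots of unity\<close>

text \<open>Horner evaluation at a complex point; the coefficients stay in \<int>, where the parity
  arguments take place.\<close>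

definition ipeval :: "int poly \<Rightarrow> complex \<Rightarrow> complex"
  where "ipeval f = fold_coeffs (\<lambda>a g z. of_int a + z * g z) f (\<lambda>z. 0)"

lemma ipeval_0 [simp]: "ipeval 0 z = 0"
  by (simp add: ipeval_def)

lemma ipeval_pCons [simp]: "ipeval (pCons a f) z = of_int a + z * ipeval f z"
  by (cases "f = 0 \<and> a = 0") (auto simp: ipeval_def)

lemma ipeval_1 [simp]: "ipeval 1 z = 1"
  by (simp add: one_pCons)

lemma ipeval_add [simp]: "ipeval (f + g) z = ipeval f z + ipeval g z"
  by (induction f g rule: poly_induct2) (simp_all add: algebra_simps)

lemma ipeval_smult [simp]: "ipeval (smult a f) z = of_int a * ipeval f z"
  by (induction f) (simp_all add: algebra_simps)

lemma ipeval_mult [simp]: "ipeval (f * g) z = ipeval f z * ipeval g z"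
  by (induction f) (simp_all add: algebra_simps)

lemma ipeval_uminus [simp]: "ipeval (- f) z = - ipeval f z"
  using ipeval_smult[of "-1" f z] by simp

lemma ipeval_diff [simp]: "ipeval (f - g) z = ipeval f z - ipeval g z"
  using ipeval_add[of f "- g" z] by simp

lemma ipeval_power [simp]: "ipeval (f ^ n) z = ipeval f z ^ n"
  by (induction n) simp_all

lemma ipeval_sum: "ipeval (\<Sum>i\<in>A. f i) z = (\<Sum>i\<in>A. ipeval (f i) z)"
  by (induction A rule: infinite_finite_induct) simp_all

lemma ipeval_monom: "ipeval (monom c n) z = of_int c * z ^ n"
  by (induction n) (simp_all add: monom_0 monom_Suc algebra_simps)

lemma ipeval_pcompose: "ipeval (pcompose f g) z = ipeval f (ipeval g z)"
  by (induction f) (simp_all add: pcompose_pCons)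

lemma ipeval_of_int: "ipeval f (of_int z) = of_int (poly f z)"
  by (induction f) simp_all

lemma ipeval_even_odd_parts: "\<exists>E D. \<forall>z. ipeval f z = ipeval E (z\<^sup>2) + z * ipeval D (z\<^sup>2)"
proof (induction f)
  case 0
  show ?case by (intro exI[of _ 0]) simp
next
  case (pCons a f)
  then obtain E D where "\<And>z. ipeval f z = ipeval E (z\<^sup>2) + z * ipeval D (z\<^sup>2)" by blast
  then show ?case
    by (intro exI[of _ "pCons a D"] exI[of _ E]) (simp add: algebra_simps power2_eq_square)
qed

text \<open>The product \<open>f(z) f(-z)\<close> is an integer polynomial in \<open>z\<^sup>2\<close>, again odd at \<open>1\<close>.\<close>

lemma ipeval_root_of_unity_nonzero:
  assumes "odd (poly f 1)"
  shows "ipeval f (e2pi (1 / 2 ^ K)) \<noteq> 0"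
  using assms
proof (induction K arbitrary: f)
  case 0
  have "ipeval f 1 = of_int (poly f 1)" using ipeval_of_int[of f 1] by simp
  moreover have "poly f 1 \<noteq> 0" using 0 by (metis dvd_0_right)
  ultimately show ?case by (simp add: e2pi_Ints)
next
  case (Suc K)
  let ?w = "e2pi (1 / 2 ^ Suc K)"
  have sq: "?w\<^sup>2 = e2pi (1 / 2 ^ K)"
    by (simp add: power2_eq_square e2pi_add[symmetric])
  obtain E D where ED: "\<And>z. ipeval f z = ipeval E (z\<^sup>2) + z * ipeval D (z\<^sup>2)"
    using ipeval_even_odd_parts by blast
  have "of_int (poly f 1) = (of_int (poly E 1 + poly D 1) :: complex)"
    using ED[of 1] ipeval_of_int[of f 1] ipeval_of_int[of E 1] ipeval_of_int[of D 1] by simp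
  then have f1: "poly f 1 = poly E 1 + poly D 1" by (simp only: of_int_eq_iff)
  let ?g = "E * E - [:0, 1:] * D * D"
  \<comment> \<open>The factors are the values of \<open>f\<close> at 1 and -1, which have the same
    parity.\<close>
  have "poly ?g 1 = (poly E 1 + poly D 1) * (poly E 1 - poly D 1)"
    by (simp add: algebra_simps)
  then have "odd (poly ?g 1)" using Suc.prems f1 by simp
  then have "ipeval ?g (?w\<^sup>2) \<noteq> 0" unfolding sq by (rule Suc.IH)
  moreover have "ipeval ?g (?w\<^sup>2) = ipeval f ?w * (ipeval E (?w\<^sup>2) - ?w * ipeval D (?w\<^sup>2))"
    unfolding ED by (simp add: algebra_simps power2_eq_square)
  ultimately show ?case by auto
qed

text \<open>The Frobenius congruence modulo 2. The error term is divisible by x as well, since the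
  constant terms agree; this extra x is what later gives the cofactor of 2 an odd constant
  term.\<close>

lemma one_plus_x_power_two_power:
  "\<exists>M :: int poly. [:1, 1:] ^ 2 ^ K = monom 1 (2 ^ K) + 1 + 2 * [:0, 1:] * M"
proof (induction K)
  case 0
  show ?case by (intro exI[of _ 0]) (simp add: monom_Suc monom_0 one_pCons)
next
  case (Suc K)
  then obtain M :: "int poly" where M: "[:1, 1:] ^ 2 ^ K = monom 1 (2 ^ K) + 1 + 2 * [:0, 1:] * M" by blast
  let ?x = "[:0, 1 :: int:]"
  have mon: "monom (1 :: int) n = ?x ^ n" for n by (simp add: monom_altdef)
  have "[:1, 1 :: int:] ^ 2 ^ Suc K = (?x ^ 2 ^ K + 1 + 2 * ?x * M)\<^sup>2"
    unfolding M[unfolded mon, symmetric] by (simp add: power_mult[symmetric] mult.commute)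
  also have "\<dots> = ?x ^ 2 ^ Suc K + 1 + 2 * ?x * (?x ^ (2 ^ K - 1) + 2 * M * (?x ^ 2 ^ K + 1) + 2 * ?x * M * M)"
  proof -
    have 1: "?x * ?x ^ (2 ^ K - 1) = ?x ^ 2 ^ K" by (simp add: power_Suc[symmetric] del: power_Suc)
    have 2: "?x ^ 2 ^ Suc K = ?x ^ 2 ^ K * ?x ^ 2 ^ K" by (simp add: power_add[symmetric] mult_2)
    have "(z + 1 + 2 * x * M)\<^sup>2 = z * z + 1 + 2 * x * (y + 2 * M * (z + 1) + 2 * x * M * M)"
      if "x * y = z" for x y z :: "int poly"
      unfolding that[symmetric] by algebra
    from this[OF 1] show ?thesis unfolding 2 .
  qed
  finally show ?case unfolding mon by blast
qed

text \<open>Composing with x - 1 turns the constant term of \<open>G\<close> into the value at 1, so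
  the criterion at roots of unity applies.\<close>

lemma ipeval_odd_constant_nonzero:
  assumes "odd (coeff G 0)"
  shows "ipeval G (e2pi (1 / 2 ^ K) - 1) \<noteq> 0"
proof -
  have "odd (poly (pcompose G [:-1, 1:]) 1)"
    using assms by (simp add: poly_pcompose poly_0_coeff_0)
  from ipeval_root_of_unity_nonzero[OF this] show ?thesis
    by (simp add: ipeval_pcompose)
qed

text \<open>Write \<open>\<pi> = \<omega> - 1\<close>, so that \<open>\<pi>\<close> to the power \<open>2 ^ K\<close> is \<open>2\<close> times a unit. If \<open>e\<close> is the
  least index of an odd coefficient, \<open>\<pi> ^ e\<close> can be divided out of the relation, which leaves one
  with odd constant term.\<close>

lemma ipeval_eq_0_imp_even:
  assumes deg: "\<And>j. 2 ^ K \<le> j \<Longrightarrow> coeff F j = 0"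
    and F: "ipeval F (e2pi (1 / 2 ^ Suc K) - 1) = 0"
  shows "even (coeff F j)"
proof (rule ccontr)
  assume "odd (coeff F j)"
  define h :: nat where "h = 2 ^ K"
  define \<pi> where "\<pi> = e2pi (1 / 2 ^ Suc K) - 1"
  define e where "e = (LEAST e. odd (coeff F e))"
  have e: "odd (coeff F e)" unfolding e_def by (rule LeastI) fact
  have less_e: "even (coeff F i)" if "i < e" for i
    using not_less_Least[of i "\<lambda>e. odd (coeff F e)"] that by (auto simp: e_def)
  have "e < h" using e deg[of e] unfolding h_def by (metis dvd_0_right not_less)
  \<comment> \<open>\<open>A\<close> is half of the part below index \<open>e\<close>, whose
    coefficients are all even; \<open>G\<close> is the rest, with constant term the odd coefficient
    at \<open>e\<close>.\<close>
  define A where "A = (\<Sum>i<e. monom (coeff F i div 2) i)"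
  define G where "G = poly_shift e F"
  have F_eq: "F = smult 2 A + monom 1 e * G"
  proof (rule poly_eqI)
    fix i
    show "coeff F i = coeff (smult 2 A + monom 1 e * G) i"
    proof (cases "i < e")
      case True
      then show ?thesis
        using less_e[OF True] by (simp add: A_def G_def coeff_sum coeff_monom_mult)
    next
      case False
      then show ?thesis
        by (simp add: A_def G_def coeff_sum coeff_monom_mult coeff_poly_shift)
    qed
  qed
  obtain M :: "int poly" where M: "[:1, 1:] ^ 2 ^ K = monom 1 (2 ^ K) + 1 + 2 * [:0, 1:] * M"
    using one_plus_x_power_two_power by blast
  define \<mu> where "\<mu> = 1 + \<pi> * ipeval M \<pi>"
  have "e2pi (1 / 2 ^ Suc K) ^ h = - 1"
    by (simp add: e2pi_power[symmetric] h_def)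
  moreover have "ipeval ([:1, 1:] ^ 2 ^ K) \<pi> = e2pi (1 / 2 ^ Suc K) ^ h"
    by (simp add: \<pi>_def h_def)
  ultimately have "- 1 = ipeval (monom 1 (2 ^ K) + 1 + 2 * [:0, 1:] * M) \<pi>"
    using M by simp
  also have "\<dots> = \<pi> ^ h + 1 + 2 * \<pi> * ipeval M \<pi>"
    using ipeval_smult[of 2 "[:0, 1:] * M" \<pi>]
    by (simp add: ipeval_monom h_def numeral_poly)
  finally have \<pi>h: "\<pi> ^ h = - 2 * \<mu>" by (simp add: \<mu>_def algebra_simps eq_neg_iff_add_eq_0)
  \<comment> \<open>Multiplying F(\<pi>) = 0 by \<mu> allows 2 \<mu> to be replaced by - \<pi>^h. As
    e < h, every term then contains \<pi>^e.\<close>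
  have "\<pi> ^ e * (ipeval G \<pi> * \<mu> - \<pi> ^ (h - e) * ipeval A \<pi>) =
      \<pi> ^ e * ipeval G \<pi> * \<mu> - \<pi> ^ h * ipeval A \<pi>"
    using \<open>e < h\<close> by (simp add: algebra_simps power_add[symmetric])
  also have "\<dots> = \<mu> * ipeval F \<pi>"
    unfolding \<pi>h by (subst F_eq) (simp add: ipeval_monom algebra_simps)
  also have "\<dots> = 0" using F by (simp add: \<pi>_def)
  finally have "\<pi> ^ e * (ipeval G \<pi> * \<mu> - \<pi> ^ (h - e) * ipeval A \<pi>) = 0" .
  moreover have "\<pi> \<noteq> 0"
    using ipeval_odd_constant_nonzero[of "[:1, 1:]" "Suc K"] \<open>e2pi (1 / 2 ^ Suc K) ^ h = - 1\<close>
    by (auto simp: \<pi>_def)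
  ultimately have "ipeval (G * (1 + [:0, 1:] * M) - monom 1 (h - e) * A) \<pi> = 0"
    by (simp add: \<mu>_def ipeval_monom)
  \<comment> \<open>Because h - e > 0 the second summand has no constant term, so the constant term
    is that of \<open>G\<close>.\<close>
  moreover have "odd (coeff (G * (1 + [:0, 1:] * M) - monom 1 (h - e) * A) 0)"
    using e \<open>e < h\<close> by (simp add: coeff_mult_0 coeff_monom_mult G_def coeff_poly_shift)
  ultimately show False using ipeval_odd_constant_nonzero unfolding \<pi>_def by blast
qed

text \<open>Infinite descent: halving an even solution gives another solution, so each coefficient
  is divisible by all powers of 2.\<close>

lemma ipeval_eq_0_imp_coeff_0:
  assumes "\<And>j. 2 ^ K \<le> j \<Longrightarrow> coeff F j = 0" "ipeval F (e2pi (1 / 2 ^ Suc K) - 1) = 0"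
  shows "F = 0"
proof (rule poly_eqI)
  fix j
  have "2 ^ n dvd coeff F j" for n :: nat
    using assms
  proof (induction n arbitrary: F)
    case (Suc n)
    define G where "G = map_poly (\<lambda>c. c div 2) F"
    have F: "F = smult 2 G"
      using ipeval_eq_0_imp_even[OF Suc.prems] by (intro poly_eqI) (simp add: G_def coeff_map_poly)
    have "2 ^ n dvd coeff G j"
      by (rule Suc.IH) (use Suc.prems in \<open>auto simp: F\<close>)
    then show ?case by (simp add: F)
  qed simp
  \<comment> \<open>The exponent is chosen because 2^n exceeds n, so a nonzero coefficient c is not
    divisible by 2 to the power |c|.\<close>
  from this[of "nat \<bar>coeff F j\<bar>"] show "coeff F j = coeff 0 j"
  proof (rule contrapos_pp)
    assume "coeff F j \<noteq> coeff 0 j"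
    moreover have "\<bar>coeff F j\<bar> < 2 ^ nat \<bar>coeff F j\<bar>"
      using of_nat_less_two_power[of "nat \<bar>coeff F j\<bar>", where 'a = int] by simp
    ultimately show "\<not> 2 ^ nat \<bar>coeff F j\<bar> dvd coeff F j"
      using zdvd_not_zless[of "\<bar>coeff F j\<bar>" "2 ^ nat \<bar>coeff F j\<bar>"] by auto
  qed
qed

text \<open>Substituting x + 1 for x passes from powers of w to powers of w - 1. It preserves the
  degree, so the bound 2^K stays valid, and it is injective.\<close>

lemma root_of_unity_lin_indep:
  fixes c :: "nat \<Rightarrow> int"
  assumes "(\<Sum>j<2 ^ K. of_int (c j) * e2pi (1 / 2 ^ Suc K) ^ j) = 0" "j < 2 ^ K"
  shows "c j = 0"
proof -
  define f where "f = (\<Sum>j<2 ^ K. monom (c j) j)"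
  have cf: "coeff f i = (if i < 2 ^ K then c i else 0)" for i
    by (simp add: f_def coeff_sum)
  have "degree (pcompose f [:1, 1:]) < 2 ^ K"
  proof -
    have "degree f \<le> 2 ^ K - 1" by (rule degree_le) (auto simp: cf)
    moreover have "(0 :: nat) < 2 ^ K" by simp
    ultimately have "degree f < 2 ^ K" by linarith
    then show ?thesis by (simp add: degree_pcompose)
  qed
  then have "pcompose f [:1, 1:] = 0"
  proof (intro ipeval_eq_0_imp_coeff_0[of K])
    show "coeff (pcompose f [:1, 1:]) j = 0" if "2 ^ K \<le> j" for j
      using that \<open>degree (pcompose f [:1, 1:]) < 2 ^ K\<close> by (intro coeff_eq_0) simp
    show "ipeval (pcompose f [:1, 1:]) (e2pi (1 / 2 ^ Suc K) - 1) = 0"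
      using assms(1) by (simp add: ipeval_pcompose f_def ipeval_sum ipeval_monom)
  qed
  then have "f = 0" by (rule pcompose_eq_0) simp
  then show ?thesis using cf[of j] assms(2) by simp
qed


section \<open>Normal forms with the same interpretation\<close>

text \<open>Row and column index together prescribe the boundary variables, so a matrix entry is the
  sum over one fibre of internal assignments.\<close>

lemma interp_nf:
  assumes V: "finite V" "{..<N} \<subseteq> V" and m: "m \<le> N"
  shows "interp (nf m N s V p) (map (\<lambda>i. of_bool (x i)) [0..<m]) (map (\<lambda>i. of_bool (x i)) [m..<N]) =
    of_real s * (\<Sum>v | v \<in> asg V \<and> (\<forall>j<N. v j = x j). e2pi (p v))"
proof -
  let ?t = "nf m N s V p"
  let ?X = "map (\<lambda>i. of_bool (x i) :: bit) [0..<m]" and ?Y = "map (\<lambda>i. of_bool (x i) :: bit) [m..<N]"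
  have wf: "wf_sop ?t" unfolding nf_def by (rule wf_mk[OF V(1)])
  have amp: "path_amp ?t ?X ?Y v = (if \<forall>j<N. v j = x j then e2pi (p v) else 0)" if v: "v \<in> asg V" for v
  proof -
    have "(?X = map (\<lambda>i. of_bool (v i)) [0..<m]) = (\<forall>j\<in>{0..<m}. v j = x j)"
      "(?Y = map (\<lambda>i. of_bool (v i)) [m..<N]) = (\<forall>j\<in>{m..<N}. v j = x j)"
      by auto
    moreover have "{..<N} = {0..<m} \<union> {m..<N}" using m by auto
    ultimately have match: "(?X = map (\<lambda>i. of_bool (v i)) [0..<m] \<and> ?Y = map (\<lambda>i. of_bool (v i)) [m..<N]) =
        (\<forall>j\<in>{..<N}. v j = x j)"
      by (simp only: ball_Un)
    have kb: "map (peval v) (kets ?t) = map (\<lambda>i. of_bool (v i)) [0..<m]"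
      "map (peval v) (bras ?t) = map (\<lambda>i. of_bool (v i)) [m..<N]"
      using V(1) v m by (simp_all add: nf_def mk_def take_map drop_map) (auto simp: asg_def)
    have ph: "peval v (phase ?t) = p v"
      using V(1) v by (simp add: nf_def mk_def restrict_asg)
    show ?thesis
      unfolding path_amp_def ketbra_def kb ph match by auto
  qed
  have "(\<Sum>v\<in>asg V. path_amp ?t ?X ?Y v) = (\<Sum>v\<in>asg V. if \<forall>j<N. v j = x j then e2pi (p v) else 0)"
    by (rule sum.cong) (simp_all add: amp)
  also have "\<dots> = (\<Sum>v | v \<in> asg V \<and> (\<forall>j<N. v j = x j). e2pi (p v))"
    by (rule sum.inter_filter[symmetric, OF finite_asg[OF V(1)]])
  finally show ?thesis
    using interp_eq_sum_asg[OF wf] by (simp add: nf_def mk_def)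
qed

text \<open>The exponent of \<open>- \<omega> ^ j\<close>, where \<open>\<omega>\<close> is a primitive root of unity of order \<open>2 ^ Suc K\<close>.\<close>

definition opp :: "nat \<Rightarrow> nat \<Rightarrow> nat"
  where "opp K j = (if j < 2 ^ K then j + 2 ^ K else j - 2 ^ K)"

lemma opp_less: "j < 2 ^ Suc K \<Longrightarrow> opp K j < 2 ^ Suc K"
  by (auto simp: opp_def)

lemma opp_neq: "opp K j \<noteq> j"
proof -
  have "(if j < n then j + n else j - n) \<noteq> j" if "0 < n" for n :: nat using that by auto
  from this[of "2 ^ K"] show ?thesis by (simp add: opp_def)
qed

lemma opp_phase: "real (opp K j) / 2 ^ Suc K - (real j / 2 ^ Suc K + 1 / 2) \<in> \<int>"
proof (cases "j < 2 ^ K")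
  case True
  then have "real (opp K j) = real j + 2 ^ K" by (simp add: opp_def)
  then have "real (opp K j) / 2 ^ Suc K - (real j / 2 ^ Suc K + 1 / 2) = 0"
    by (simp add: add_divide_distrib)
  then show ?thesis by (simp only: Ints_0)
next
  case False
  then have "real (opp K j) = real j - 2 ^ K" by (simp add: opp_def of_nat_diff)
  then have "real (opp K j) / 2 ^ Suc K - (real j / 2 ^ Suc K + 1 / 2) = - 1"
    by (simp add: diff_divide_distrib)
  then show ?thesis by (simp only: Ints_minus Ints_1)
qed

text \<open>Folding the upper half of the exponents onto the lower one by w^(j + 2^K) = - w^j leaves
  differences of counts as coefficients, and linear independence equates them. For \<open>j\<close>
  in the upper half both differences change sign.\<close>

lemma root_sum_eq_imp_counts:
  assumes F: "finite F" and c: "\<And>v. v \<in> F \<Longrightarrow> c v < 2 ^ Suc K" and d: "\<And>v. v \<in> F \<Longrightarrow> d v < 2 ^ Suc K"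
    and eq: "(\<Sum>v\<in>F. e2pi (1 / 2 ^ Suc K) ^ c v) = (\<Sum>v\<in>F. e2pi (1 / 2 ^ Suc K) ^ d v)"
    and j: "j < 2 ^ Suc K"
  shows "int (card {v\<in>F. c v = j}) - int (card {v\<in>F. c v = opp K j}) =
    int (card {v\<in>F. d v = j}) - int (card {v\<in>F. d v = opp K j})"
proof -
  let ?w = "e2pi (1 / 2 ^ Suc K)"
  let ?H = "2 ^ K :: nat"
  define D where "D c j = int (card {v\<in>F. c v = j}) - int (card {v\<in>F. c v = j + ?H})" for c :: "'a \<Rightarrow> nat" and j
  have wH: "?w ^ ?H = - 1"
    by (simp add: e2pi_power[symmetric])
  have sum: "(\<Sum>v\<in>F. ?w ^ c v) = (\<Sum>j<?H. of_int (D c j) * ?w ^ j)"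
    if c: "\<And>v. v \<in> F \<Longrightarrow> c v < 2 ^ Suc K" for c
  proof -
    let ?n = "\<lambda>j. of_nat (card {v\<in>F. c v = j}) * ?w ^ j"
    have "(\<Sum>v\<in>F. ?w ^ c v) = (\<Sum>j<2 ^ Suc K. \<Sum>v\<in>{v\<in>F. c v = j}. ?w ^ c v)"
      using F c by (intro sum.group[symmetric]) auto
    also have "\<dots> = (\<Sum>j<?H + ?H. ?n j)"
    proof (rule sum.cong)
      show "{..<2 ^ Suc K} = {..<?H + ?H}" by (simp add: mult_2)
      fix j
      have "(\<Sum>v\<in>{v\<in>F. c v = j}. ?w ^ c v) = (\<Sum>v\<in>{v\<in>F. c v = j}. ?w ^ j)"
        by (rule sum.cong) auto
      then show "(\<Sum>v\<in>{v\<in>F. c v = j}. ?w ^ c v) = ?n j" by simp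
    qed
    also have "\<dots> = (\<Sum>j<?H. ?n j) + (\<Sum>j<?H. ?n (?H + j))"
    proof -
      have "(\<Sum>j<?H + n. f j) = (\<Sum>j<?H. f j) + (\<Sum>j<n. f (?H + j))" for n and f :: "nat \<Rightarrow> complex"
        by (induction n) (simp_all add: ac_simps)
      then show ?thesis .
    qed
    also have "\<dots> = (\<Sum>j<?H. ?n j + ?n (?H + j))"
      by (simp only: sum.distrib)
    also have "\<dots> = (\<Sum>j<?H. of_int (D c j) * ?w ^ j)"
    proof (rule sum.cong[OF refl])
      fix j
      show "?n j + ?n (?H + j) = of_int (D c j) * ?w ^ j"
        unfolding D_def power_add wH by (simp add: left_diff_distrib add.commute)
    qed
    finally show ?thesis .
  qed
  have "(\<Sum>j<?H. of_int (D c j - D d j) * ?w ^ j) = 0"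
    using eq sum[OF c] sum[OF d] by (simp add: sum_subtractf left_diff_distrib)
  then have D: "D c j = D d j" if "j < ?H" for j
    using root_of_unity_lin_indep[of "\<lambda>j. D c j - D d j" K j] that by simp
  show ?thesis
  proof (cases "j < ?H")
    case True
    then show ?thesis using D[of j] by (simp add: D_def opp_def)
  next
    case False
    then have "j - ?H < ?H" using j by simp
    from D[OF this] show ?thesis using False by (simp add: D_def opp_def)
  qed
qed

text \<open>One of the two moves always applies. The first alternative allows a swap with
  \<open>u\<close>. If it fails, \<open>c\<close> takes the value \<open>d u\<close> less often than
  \<open>d\<close> does; the totals being equal, \<open>c\<close> has a surplus of some value j, and
  by balance an equal surplus of the opposite value. Each surplus yields a mismatched
  position.\<close>

lemma mismatch_cases:
  assumes F: "finite F" and c: "\<And>v. v \<in> F \<Longrightarrow> c v < 2 ^ Suc K" and d: "\<And>v. v \<in> F \<Longrightarrow> d v < 2 ^ Suc K"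
    and bal: "\<And>j. j < 2 ^ Suc K \<Longrightarrow>
      int (card {v\<in>F. c v = j}) - int (card {v\<in>F. c v = opp K j}) =
      int (card {v\<in>F. d v = j}) - int (card {v\<in>F. d v = opp K j})"
    and u: "u \<in> F" "c u \<noteq> d u"
  shows "(\<exists>v\<in>F. c v = d u \<and> d v \<noteq> d u) \<or>
    (\<exists>v\<in>F. \<exists>v'\<in>F. c v' = opp K (c v) \<and> c v \<noteq> d v \<and> c v' \<noteq> d v')"
proof (rule disjCI)
  assume no2: "\<not> (\<exists>v\<in>F. \<exists>v'\<in>F. c v' = opp K (c v) \<and> c v \<noteq> d v \<and> c v' \<noteq> d v')"
  show "\<exists>v\<in>F. c v = d u \<and> d v \<noteq> d u"
  proof (rule ccontr)
    assume no1: "\<not> ?thesis"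
    let ?nc = "\<lambda>j. card {v\<in>F. c v = j}" and ?nd = "\<lambda>j. card {v\<in>F. d v = j}"
    have "{v\<in>F. c v = d u} \<subset> {v\<in>F. d v = d u}" using no1 u by auto
    then have lt: "?nc (d u) < ?nd (d u)" using F by (intro psubset_card_mono) auto
    have excess: "\<exists>v\<in>F. c v = j \<and> d v \<noteq> j" if "?nd j < ?nc j" for j
    proof (rule ccontr)
      assume "\<not> ?thesis"
      then have "{v\<in>F. c v = j} \<subseteq> {v\<in>F. d v = j}" by auto
      then have "?nc j \<le> ?nd j" using F by (intro card_mono) auto
      with that show False by simp
    qed
    have total: "(\<Sum>j<2 ^ Suc K. card {v\<in>F. g v = j}) = card F"
      if "\<And>v. v \<in> F \<Longrightarrow> g v < 2 ^ Suc K" for g :: "'a \<Rightarrow> nat"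
      using sum.group[of F "{..<2 ^ Suc K}" g "\<lambda>_. 1 :: nat"] F that by auto
    have "\<exists>j<2 ^ Suc K. ?nd j < ?nc j"
    proof (rule ccontr)
      assume "\<not> ?thesis"
      then have "\<forall>j\<in>{..<2 ^ Suc K}. ?nc j \<le> ?nd j" by (meson lessThan_iff not_less)
      moreover have "\<exists>j\<in>{..<2 ^ Suc K}. ?nc j < ?nd j" using lt d[OF u(1)] by blast
      ultimately have "(\<Sum>j<2 ^ Suc K. ?nc j) < (\<Sum>j<2 ^ Suc K. ?nd j)"
        by (intro sum_strict_mono_ex1) simp_all
      then show False using total[of c] total[of d] c d by simp
    qed
    then obtain j where j: "j < 2 ^ Suc K" "?nd j < ?nc j" by blast
    \<comment> \<open>Rearranged, the balance says that \<open>c\<close> and \<open>d\<close> differ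
      by the same amount at j and at its opposite.\<close>
    then have "?nd (opp K j) < ?nc (opp K j)" using bal[of j] by simp
    with j excess no2 show False by metis
  qed
qed

text \<open>Induction on the number of assignments at which the phases differ. Swaps and
  cancellations stay within one fibre over the boundary, where both sides have the same sum of roots
  of unity. Soundness keeps the interpretations equal after each move, so the induction hypothesis
  applies.\<close>

lemma nf_complete_nat:
  assumes V: "finite V" "{..<N} \<subseteq> V" and m: "m \<le> N" and s: "s \<noteq> 0"
    and d: "\<And>v. d v < 2 ^ Suc K" and c: "\<And>v. c v < 2 ^ Suc K"
    and eq: "interp (nf m N s V (\<lambda>v. real (c v) / 2 ^ Suc K)) = interp (nf m N s V (\<lambda>v. real (d v) / 2 ^ Suc K))"
  shows "nf m N s V (\<lambda>v. real (c v) / 2 ^ Suc K) \<sim>\<^sub>T\<^sub>H nf m N s V (\<lambda>v. real (d v) / 2 ^ Suc K)"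
  using c eq
proof (induction "card {v\<in>asg V. c v \<noteq> d v}" arbitrary: c rule: less_induct)
  case less
  let ?n = "\<lambda>c. nf m N s V (\<lambda>v. real (c v :: nat) / 2 ^ Suc K)"
  let ?mis = "\<lambda>c. {v\<in>asg V. c v \<noteq> d v}"
  have fin: "finite (?mis c)" for c using finite_asg[OF V(1)] by simp
  show ?case
  proof (cases "?mis c = {}")
    case True
    then show ?thesis using V by (intro nf_cong) auto
  next
    case False
    then obtain u where u: "u \<in> asg V" "c u \<noteq> d u" by auto
    define F where "F = {v. v \<in> asg V \<and> (\<forall>j<N. v j = u j)}"
    have F: "finite F" unfolding F_def using finite_asg[OF V(1)] by simp
    have uF: "u \<in> F" using u by (simp add: F_def)
    have FV: "v \<in> asg V" if "v \<in> F" for v using that by (simp add: F_def)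
    have agree: "v j = w j" if "v \<in> F" "w \<in> F" "j < N" for v w j using that by (simp add: F_def)
    \<comment> \<open>Formulated for a \<open>c1\<close> with no more mismatches than
      \<open>c\<close>, so that it also applies after a cancellation, the decrease being measured
      against \<open>c\<close>.\<close>
    have match: "?n c1 \<sim>\<^sub>T\<^sub>H ?n d"
      if c1: "\<And>v. c1 v < 2 ^ Suc K" "interp (?n c1) = interp (?n d)" "?mis c1 \<subseteq> ?mis c"
        and u1: "c1 u \<noteq> d u" and v: "v \<in> F" "c1 v = d u" "d v \<noteq> d u" for c1 v
    proof -
      let ?c2 = "c1(u := c1 v, v := c1 u)"
      have "?n c1 \<sim>\<^sub>T\<^sub>H nf m N s V ((\<lambda>v. real (c1 v) / 2 ^ Suc K)
          (u := real (c1 v) / 2 ^ Suc K, v := real (c1 u) / 2 ^ Suc K))"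
        using FV[OF uF] FV[OF v(1)] agree[OF uF v(1)] by (intro nf_transpose V) auto
      also have "(\<lambda>v. real (c1 v) / 2 ^ Suc K)(u := real (c1 v) / 2 ^ Suc K, v := real (c1 u) / 2 ^ Suc K) =
          (\<lambda>v. real (?c2 v) / 2 ^ Suc K)"
        by (rule ext) simp
      finally have step: "?n c1 \<sim>\<^sub>T\<^sub>H ?n ?c2" .
      have "u \<noteq> v" using u1 v by auto
      \<comment> \<open>The swap matches \<open>u\<close>; position \<open>v\<close> was mismatched
        already, so no new mismatch arises.\<close>
      then have sub2: "?mis ?c2 \<subseteq> ?mis c1 - {u}" using v u1 FV[OF v(1)] by auto
      have gen: "A \<subset> C" if "A \<subseteq> B - {u}" "B \<subseteq> C" "u \<in> C" for A B C :: "(nat \<Rightarrow> bool) set"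
        using that by blast
      have "u \<in> ?mis c" using u by simp
      then have "?mis ?c2 \<subset> ?mis c" by (rule gen[OF sub2 c1(3)])
      then have "card (?mis ?c2) < card (?mis c)" by (rule psubset_card_mono[OF fin])
      moreover have "?c2 w < 2 ^ Suc K" for w using c1(1) by (simp del: power_Suc)
      moreover have "interp (?n ?c2) = interp (?n d)"
        using interp_th_equiv[OF step] c1(2) by (rule trans[OF sym])
      ultimately have "?n ?c2 \<sim>\<^sub>T\<^sub>H ?n d" by (rule less.hyps)
      with step show ?thesis by (rule th_equiv_trans)
    qed
    have "(\<Sum>v\<in>F. e2pi (real (c v) / 2 ^ Suc K)) = (\<Sum>v\<in>F. e2pi (real (d v) / 2 ^ Suc K))"
    proof -
      let ?X = "map (\<lambda>i. of_bool (u i)) [0..<m]" and ?Y = "map (\<lambda>i. of_bool (u i)) [m..<N]"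
      have "interp (?n c) ?X ?Y = interp (?n d) ?X ?Y" by (simp only: less.prems(2))
      then show ?thesis
        unfolding interp_nf[OF V m] F_def[symmetric] using s by (simp only: mult_cancel_left of_real_eq_0_iff simp_thms)
    qed
    then have sums: "(\<Sum>v\<in>F. e2pi (1 / 2 ^ Suc K) ^ c v) = (\<Sum>v\<in>F. e2pi (1 / 2 ^ Suc K) ^ d v)"
      by (simp add: e2pi_power[symmetric])
    have "(\<exists>v\<in>F. c v = d u \<and> d v \<noteq> d u) \<or>
        (\<exists>v\<in>F. \<exists>v'\<in>F. c v' = opp K (c v) \<and> c v \<noteq> d v \<and> c v' \<noteq> d v')"
    proof (rule mismatch_cases[where c = c and d = d and u = u, OF F _ _ _ uF u(2)])
      show "int (card {v\<in>F. c v = j}) - int (card {v\<in>F. c v = opp K j}) =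
          int (card {v\<in>F. d v = j}) - int (card {v\<in>F. d v = opp K j})" if "j < 2 ^ Suc K" for j
        by (rule root_sum_eq_imp_counts[where c = c and d = d, OF F _ _ sums that]) (rule less.prems(1) d)+
    qed (rule less.prems(1) d)+
    then show ?thesis
    proof
      assume "\<exists>v\<in>F. c v = d u \<and> d v \<noteq> d u"
      then show ?thesis using match[of c] less.prems u by blast
    next
      assume "\<exists>v\<in>F. \<exists>v'\<in>F. c v' = opp K (c v) \<and> c v \<noteq> d v \<and> c v' \<noteq> d v'"
      then obtain v v' where v: "v \<in> F" "v' \<in> F" "c v' = opp K (c v)" "c v \<noteq> d v" "c v' \<noteq> d v'"
        by blast
      have vv': "v \<noteq> v'" using v(3) opp_neq[of K "c v"] by auto
      let ?l = "d u"
      \<comment> \<open>The pair is overwritten by the value wanted at \<open>u\<close> and its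
        opposite. Both positions were mismatched, so the mismatches cannot grow.\<close>
      let ?c1 = "c(v := ?l, v' := opp K ?l)"
      have "?n c \<sim>\<^sub>T\<^sub>H nf m N s V ((\<lambda>v. real (c v) / 2 ^ Suc K)
          (v := real ?l / 2 ^ Suc K, v' := real ?l / 2 ^ Suc K + 1 / 2))"
      proof (rule nf_cancel[OF V(1)])
        show "real (c v') / 2 ^ Suc K - (real (c v) / 2 ^ Suc K + 1 / 2) \<in> \<int>"
          unfolding v(3) by (rule opp_phase)
      qed (use v agree FV in auto)
      also have "\<dots> \<sim>\<^sub>T\<^sub>H ?n ?c1"
      proof (rule nf_cong[OF V(1)])
        fix w
        have "- (real (opp K ?l) / 2 ^ Suc K - (real ?l / 2 ^ Suc K + 1 / 2)) \<in> \<int>"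
          by (rule Ints_minus[OF opp_phase])
        then show "((\<lambda>v. real (c v) / 2 ^ Suc K)(v := real ?l / 2 ^ Suc K, v' := real ?l / 2 ^ Suc K + 1 / 2)) w
            - real (?c1 w) / 2 ^ Suc K \<in> \<int>"
          using vv' by (cases "w = v'"; cases "w = v") simp_all
      qed
      finally have step: "?n c \<sim>\<^sub>T\<^sub>H ?n ?c1" .
      have bound: "?c1 w < 2 ^ Suc K" for w using less.prems(1) d opp_less[of ?l K] by simp
      have int: "interp (?n ?c1) = interp (?n d)" using interp_th_equiv[OF step] less.prems(2) by simp
      have sub: "?mis ?c1 \<subseteq> ?mis c" using v by auto
      have "?n ?c1 \<sim>\<^sub>T\<^sub>H ?n d"
      proof (cases "?mis ?c1 = ?mis c")
        case False
        then have "card (?mis ?c1) < card (?mis c)" using sub by (intro psubset_card_mono[OF fin]) auto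
        then show ?thesis using bound int by (rule less.hyps)
      next
        case True
        \<comment> \<open>If no mismatch has disappeared, \<open>v\<close> now holds
          \<open>d u\<close> but needs another value, so a swap with \<open>u\<close> makes
          progress.\<close>
        have "v \<in> ?mis ?c1" "u \<in> ?mis ?c1" unfolding True using v u FV by auto
        then show ?thesis using match[OF bound int sub _ v(1)] vv' by simp
      qed
      with step show ?thesis by (rule th_equiv_trans)
    qed
  qed
qed


section \<open>Reduction to normal form\<close>

definition dyadic :: "nat \<Rightarrow> ((nat \<Rightarrow> bool) \<Rightarrow> real) \<Rightarrow> bool"
  where "dyadic K p \<longleftrightarrow> (\<forall>v. 2 ^ K * p v \<in> \<int>)"

lemma dyadic_add: "dyadic K p \<Longrightarrow> dyadic K q \<Longrightarrow> dyadic K (\<lambda>v. p v + q v)"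
  by (simp add: dyadic_def distrib_left)

lemma dyadicI: "i \<le> K \<Longrightarrow> (\<And>v. 2 ^ i * p v \<in> \<int>) \<Longrightarrow> dyadic K p"
  unfolding dyadic_def
proof
  fix v assume i: "i \<le> K" and p: "\<And>v. 2 ^ i * p v \<in> \<int>"
  have "2 ^ K * p v = 2 ^ (K - i) * (2 ^ i * p v)"
    using i by (simp add: power_add[symmetric])
  also have "\<dots> \<in> \<int>" by (rule Ints_mult[OF _ p]) simp
  finally show "2 ^ K * p v \<in> \<int>" .
qed

text \<open>Modulo \<int> each phase is a fraction with denominator 2^(K+1) and a numerator in the
  range of residues, which turns the phases into natural exponents.\<close>

lemma nf_complete:
  assumes V: "finite V" "{..<N} \<subseteq> V" and m: "m \<le> N" and s: "s \<noteq> 0"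
    and p: "dyadic (Suc K) p" and q: "dyadic (Suc K) q"
    and eq: "interp (nf m N s V p) = interp (nf m N s V q)"
  shows "nf m N s V p \<sim>\<^sub>T\<^sub>H nf m N s V q"
proof -
  define c where "c p v = nat (\<lfloor>2 ^ Suc K * p v\<rfloor> mod 2 ^ Suc K)" for p :: "(nat \<Rightarrow> bool) \<Rightarrow> real" and v
  have bound: "c p v < 2 ^ Suc K" for p v
    by (simp add: c_def nat_less_iff del: power_Suc)
  have int: "p v - real (c p v) / 2 ^ Suc K \<in> \<int>" if p: "dyadic (Suc K) p" for p v
  proof -
    let ?M = "2 ^ Suc K :: int"
    have "2 ^ Suc K * p v \<in> \<int>" using p by (simp only: dyadic_def)
    then obtain z where z: "2 ^ Suc K * p v = of_int z" by (rule Ints_cases)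
    have "real (c p v) = of_int (z mod ?M)"
      unfolding c_def z by (simp del: power_Suc)
    moreover have "of_int z = (2 ^ Suc K * of_int (z div ?M) + of_int (z mod ?M) :: real)"
      using arg_cong[OF mult_div_mod_eq[of ?M z, symmetric], of "of_int :: int \<Rightarrow> real"]
      by (simp only: of_int_add of_int_mult of_int_numeral of_int_power)
    ultimately have "2 ^ Suc K * p v = 2 ^ Suc K * of_int (z div ?M) + real (c p v)"
      using z by linarith
    then have "p v - real (c p v) / 2 ^ Suc K = of_int (z div ?M)"
      by (simp add: field_simps del: power_Suc)
    then show ?thesis by simp
  qed
  have to_c: "nf m N s V p \<sim>\<^sub>T\<^sub>H nf m N s V (\<lambda>v. real (c p v) / 2 ^ Suc K)" if "dyadic (Suc K) p" for p
    by (rule nf_cong[OF V(1) int[OF that]])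
  have "nf m N s V (\<lambda>v. real (c p v) / 2 ^ Suc K) \<sim>\<^sub>T\<^sub>H nf m N s V (\<lambda>v. real (c q v) / 2 ^ Suc K)"
    using interp_th_equiv[OF to_c[OF p]] interp_th_equiv[OF to_c[OF q]] eq
    by (intro nf_complete_nat[OF V m s bound bound]) simp
  then show ?thesis using to_c[OF p] th_equiv_sym[OF to_c[OF q]] th_equiv_trans by blast
qed

lemma divide_sqrt2_powi:
  "1 / (sqrt 2 powi q) / (sqrt 2 ^ a * 2 ^ b) = 1 / (sqrt 2 powi (q + int a + 2 * int b))"
proof -
  have "sqrt 2 powi (q + int a + 2 * int b) = sqrt 2 powi q * sqrt 2 powi int a * sqrt 2 powi int (2 * b)"
    by (simp add: power_int_add)
  also have "\<dots> = sqrt 2 powi q * sqrt 2 ^ a * 2 ^ b"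
    by (simp only: power_int_of_nat power_mult) simp
  finally show ?thesis by simp
qed

text \<open>Each new variable divides the scalar by sqrt 2 when it comes from the rule
  \<open>sqrt2\<close>, and by 2 when it comes from Elim. The bound 3 on \<open>K\<close>
  accommodates the eighths of the former.\<close>

lemma nf_add_vars:
  assumes N: "N \<le> L" and K: "3 \<le> K" and p: "dyadic K p"
  shows "\<exists>p'. dyadic K p' \<and>
    nf m N s {..<L} p \<sim>\<^sub>T\<^sub>H nf m N (s / (sqrt 2 ^ a * 2 ^ b)) {..<L + a + b} p'"
proof (induction b)
  case 0
  show ?case
  proof (induction a)
    case 0
    show ?case using p by (intro exI[of _ p]) simp
  next
    case (Suc a)
    then obtain p' where p': "dyadic K p'" and
      eq: "nf m N s {..<L} p \<sim>\<^sub>T\<^sub>H nf m N (s / sqrt 2 ^ a) {..<L + a} p'" by auto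
    let ?y = "L + a"
    \<comment> \<open>On \<open>asg {..<?y}\<close> nothing changes, but the phase becomes
      independent of the variable about to be added.\<close>
    let ?q = "\<lambda>v. p' (v(?y := False))"
    let ?r = "\<lambda>v. 1/8 + 3/4 * of_bool (v ?y) + ?q v"
    note eq
    also have "nf m N (s / sqrt 2 ^ a) {..<?y} p' \<sim>\<^sub>T\<^sub>H nf m N (s / sqrt 2 ^ a) {..<?y} ?q"
    proof (rule nf_cong)
      fix v assume "v \<in> asg {..<?y}"
      then have "v(?y := False) = v" by (intro fun_upd_idem) (auto simp: asg_def)
      then show "p' v - ?q v \<in> \<int>" by simp
    qed simp
    also have "nf m N (s / sqrt 2 ^ a) {..<?y} ?q = nf m N (sqrt 2 * (s / sqrt 2 ^ Suc a)) {..<?y} ?q"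
      by simp
    also have "\<dots> \<sim>\<^sub>T\<^sub>H
        nf m N (s / sqrt 2 ^ Suc a) (insert ?y {..<?y}) ?r"
      using N by (intro th_equiv_sym[OF nf_sqrt2]) auto
    finally have "nf m N s {..<L} p \<sim>\<^sub>T\<^sub>H nf m N (s / sqrt 2 ^ Suc a) {..<L + Suc a} ?r"
      by (simp only: lessThan_Suc add_Suc_right)
    moreover have "dyadic K ?r"
    proof (intro dyadic_add)
      show "dyadic K (\<lambda>v. 1 / 8)" "dyadic K (\<lambda>v. 3 / 4 * of_bool (v ?y))"
        using K by (auto intro!: dyadicI[of 3])
      show "dyadic K ?q" using p' by (simp add: dyadic_def)
    qed
    ultimately show ?case by (intro exI[of _ ?r]) simp
  qed
next
  case (Suc b)
  let ?s = "s / (sqrt 2 ^ a * 2 ^ b)"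
  from Suc obtain p' where p': "dyadic K p'" and
    eq: "nf m N s {..<L} p \<sim>\<^sub>T\<^sub>H nf m N ?s {..<L + a + b} p'" by auto
  let ?y = "L + a + b"
  let ?q = "\<lambda>v. p' (v(?y := False))"
  note eq
  also have "nf m N ?s {..<?y} p' \<sim>\<^sub>T\<^sub>H nf m N ?s {..<?y} ?q"
  proof (rule nf_cong)
    fix v assume "v \<in> asg {..<?y}"
    then have "v(?y := False) = v" by (intro fun_upd_idem) (auto simp: asg_def)
    then show "p' v - ?q v \<in> \<int>" by simp
  qed simp
  also have "nf m N ?s {..<?y} ?q = nf m N (2 * (s / (sqrt 2 ^ a * 2 ^ Suc b))) {..<?y} ?q"
    by simp
  also have "\<dots> \<sim>\<^sub>T\<^sub>H
      nf m N (s / (sqrt 2 ^ a * 2 ^ Suc b)) (insert ?y {..<?y}) ?q"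
    using N by (intro th_equiv_sym[OF nf_Elim]) auto
  finally have "nf m N s {..<L} p \<sim>\<^sub>T\<^sub>H nf m N (s / (sqrt 2 ^ a * 2 ^ Suc b)) {..<L + a + Suc b} ?q"
    by (simp only: lessThan_Suc add_Suc_right)
  moreover have "dyadic K ?q" using p' by (simp add: dyadic_def)
  ultimately show ?case by blast
qed

text \<open>The \<open>i\<close>-th ket or bra is replaced by the fresh variable \<open>i\<close>, using HH backwards.\<close>

lemma mk_ketbra_vars:
  assumes K: "1 \<le> K" and p: "dyadic K p" "\<And>v y c. y \<notin> {N..<N + r} \<Longrightarrow> p (v(y := c)) = p v"
    and ls: "length ls = N" "\<And>f v y c. f \<in> set ls \<Longrightarrow> y \<notin> {N..<N + r} \<Longrightarrow> f (v(y := c)) = f v"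
    and i: "i \<le> N"
  shows "\<exists>p'. dyadic K p' \<and> (\<forall>v y c. y \<notin> {..<i} \<union> {N..<N + r + i} \<longrightarrow> p' (v(y := c)) = p' v) \<and>
    mk m s {N..<N + r} p ls \<sim>\<^sub>T\<^sub>H
    mk m (s / 2 ^ i) ({..<i} \<union> {N..<N + r + i}) p' (map (\<lambda>i v. v i) [0..<i] @ drop i ls)"
  using i
proof (induction i)
  case 0
  show ?case
  proof (intro exI[of _ p] conjI allI impI)
    show "p (v(y := c)) = p v" if "y \<notin> {..<0} \<union> {N..<N + r + 0}" for v y c
      using that by (intro p(2)) simp
  qed (simp_all add: p(1))
next
  case (Suc i)
  let ?W = "\<lambda>i. {..<i} \<union> {N..<N + r + i}"
  let ?l = "\<lambda>i. map (\<lambda>i v. v i) [0..<i] @ drop i ls"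
  from Suc.IH[OF Suc_leD[OF Suc.prems]] obtain p' where p': "dyadic K p'" "\<And>v y c. y \<notin> ?W i \<Longrightarrow> p' (v(y := c)) = p' v"
    and eq: "mk m s {N..<N + r} p ls \<sim>\<^sub>T\<^sub>H mk m (s / 2 ^ i) (?W i) p' (?l i)"
    by blast
  define q where "q = ls ! i"
  have q: "q \<in> set ls" using Suc.prems ls(1) by (simp add: q_def)
  \<comment> \<open>The auxiliary variable of HH. The name \<open>i\<close> is still free because
    the summation variables start at \<open>N\<close>.\<close>
  let ?a = "N + r + i"
  let ?p = "\<lambda>v. of_bool (v ?a) / 2 * (of_bool (v i) + of_bool (q v)) + p' v"
  have W: "insert ?a (insert i (?W i)) = ?W (Suc i)" using Suc.prems by auto
  have ls_drop: "f (v(y := c)) = f v" if "f \<in> set (drop j ls)" "y \<notin> {N..<N + r}" for f v y c j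
    using ls(2)[OF in_set_dropD[OF that(1)] that(2)] .
  have ls_eq: "map (\<lambda>f v. f (v(i := q v))) (?l (Suc i)) = ?l i"
  proof -
    have "drop i ls = q # drop (Suc i) ls"
      using Suc.prems ls(1) by (simp add: q_def Cons_nth_drop_Suc)
    moreover have "map (\<lambda>f v. f (v(i := q v))) (drop (Suc i) ls) = drop (Suc i) ls"
      by (intro map_idI ext ls_drop) (use Suc.prems in auto)
    ultimately show ?thesis by simp
  qed
  have "mk m (s / 2 ^ Suc i) (insert ?a (insert i (?W i))) ?p (?l (Suc i)) \<sim>\<^sub>T\<^sub>H
    mk m (2 * (s / 2 ^ Suc i)) (?W i) (\<lambda>v. p' (v(i := q v))) (map (\<lambda>f v. f (v(i := q v))) (?l (Suc i)))"
  proof (rule mk_HH)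
    show "q (v(?a := c, i := d)) = q v" for v c d
      using ls(2)[OF q, of i "v(?a := c)" d] ls(2)[OF q, of ?a v c] Suc.prems by simp
    show "p' (v(?a := True)) = p' v" for v
      using Suc.prems by (intro p'(2)) auto
    fix f v assume "f \<in> set (?l (Suc i))"
    then have "(\<exists>j<Suc i. f = (\<lambda>v. v j)) \<or> f \<in> set (drop (Suc i) ls)" by (auto simp: less_Suc_eq)
    then consider j where "j < Suc i" "f = (\<lambda>v. v j)" | "f \<in> set (drop (Suc i) ls)" by blast
    then show "f (v(?a := True)) = f v"
    proof cases
      case 2
      then show ?thesis by (rule ls_drop) simp
    qed (use Suc.prems in auto)
  qed (use Suc.prems in auto)
  then have "mk m (s / 2 ^ Suc i) (?W (Suc i)) ?p (?l (Suc i)) \<sim>\<^sub>T\<^sub>H mk m (s / 2 ^ i) (?W i) p' (?l i)"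
    unfolding W ls_eq using p'(2)[of i] Suc.prems by simp
  with eq have "mk m s {N..<N + r} p ls \<sim>\<^sub>T\<^sub>H mk m (s / 2 ^ Suc i) (?W (Suc i)) ?p (?l (Suc i))"
    using th_equiv_sym th_equiv_trans by blast
  moreover have "dyadic K ?p"
    using K by (intro dyadic_add p'(1) dyadicI[of 1]) auto
  moreover have "?p (v(y := c)) = ?p v" if "y \<notin> ?W (Suc i)" for v y c
  proof -
    have "p' (v(y := c)) = p' v" "q (v(y := c)) = q v" "y \<noteq> ?a" "y \<noteq> i"
      using that Suc.prems by (auto intro!: p'(2) ls(2)[OF q])
    then show ?thesis by simp
  qed
  ultimately show ?case by (intro exI[of _ ?p] conjI allI impI)
qed

lemma dyadic_th_equiv_nf:
  assumes t: "t \<in> SOP_dyadic K n m"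
  shows "\<exists>q L p. m + n \<le> L \<and> dyadic (K + 3) p \<and>
    t \<sim>\<^sub>T\<^sub>H nf m (m + n) (1 / (sqrt 2 powi q)) {..<L} p"
proof -
  let ?N = "m + n"
  from t obtain e P where wf: "wf_sop t" and len: "length (kets t) = m" "length (bras t) = n"
    and s: "scalar t = 1 / (sqrt 2 powi e)" and P: "int_coeffs P" "phase t = Cst (1 / 2 ^ K) * P"
    by (auto simp: SOP_dyadic_def SOP_hom_def)
  let ?V = "svars t"
  let ?p = "\<lambda>v. peval v (phase t)" and ?ls = "map (\<lambda>q v. peval v q = 1) (kets t @ bras t)"
  have V: "finite ?V" using wf by (simp add: wf_sop_def)
  then obtain h where h: "bij_betw h ?V {0..<card ?V}" using ex_bij_betw_finite_nat by blast
  define r where "r = card ?V"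
  \<comment> \<open>Shifting by \<open>?N\<close> reserves the names below it for the kets and
    bras.\<close>
  define f where "f j = ?N + h j" for j
  have inj: "inj_on f ?V" using h by (auto simp: f_def bij_betw_def inj_on_def)
  have "f ` ?V = (\<lambda>j. ?N + j) ` (h ` ?V)" by (simp add: f_def image_image)
  also have "h ` ?V = {0..<r}" using h by (simp add: bij_betw_def r_def)
  also have "(\<lambda>j. ?N + j) ` {0..<r} = {?N..<?N + r}" by (simp add: add.commute)
  finally have fV: "f ` ?V = {?N..<?N + r}" .
  define g where "g v = (\<lambda>j. j \<in> ?V \<and> v (f j))" for v
  have g: "g (v(y := c)) = g v" if "y \<notin> {?N..<?N + r}" for v y c
    using that fV by (auto simp: g_def fun_eq_iff)
  let ?p1 = "\<lambda>v. ?p (g v)" and ?ls1 = "map (\<lambda>h v. h (g v)) ?ls"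
  have "t \<sim>\<^sub>T\<^sub>H mk m (scalar t) ?V ?p ?ls"
    using th_equiv_mk[OF wf] len by simp
  also have "\<dots> \<sim>\<^sub>T\<^sub>H mk m (scalar t) {?N..<?N + r} ?p1 ?ls1"
    using mk_rename[OF V inj, of m "scalar t" ?p ?ls] unfolding fV g_def .
  finally have 1: "t \<sim>\<^sub>T\<^sub>H mk m (scalar t) {?N..<?N + r} ?p1 ?ls1" .
  have "\<exists>p'. dyadic (K + 3) p' \<and> (\<forall>v y c. y \<notin> {..<?N} \<union> {?N..<?N + r + ?N} \<longrightarrow> p' (v(y := c)) = p' v) \<and>
    mk m (scalar t) {?N..<?N + r} ?p1 ?ls1 \<sim>\<^sub>T\<^sub>H
      mk m (scalar t / 2 ^ ?N) ({..<?N} \<union> {?N..<?N + r + ?N}) p' (map (\<lambda>i v. v i) [0..<?N] @ drop ?N ?ls1)"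
  proof (rule mk_ketbra_vars)
    show "dyadic (K + 3) ?p1"
      by (rule dyadicI[of K]) (use P in \<open>auto simp: int_coeffs_iff\<close>)
    show "?p1 (v(y := c)) = ?p1 v" if "y \<notin> {?N..<?N + r}" for v y c
      by (simp only: g[OF that])
    fix f v y c assume "f \<in> set ?ls1" and y: "y \<notin> {?N..<?N + r}"
    then obtain h where "f = (\<lambda>v. h (g v))" by auto
    then show "f (v(y := c)) = f v" by (simp only: g[OF y])
  qed (use len in simp_all)
  then obtain p' where p': "dyadic (K + 3) p'" and
    2: "mk m (scalar t) {?N..<?N + r} ?p1 ?ls1 \<sim>\<^sub>T\<^sub>H
      mk m (scalar t / 2 ^ ?N) ({..<?N} \<union> {?N..<?N + r + ?N}) p' (map (\<lambda>i v. v i) [0..<?N] @ drop ?N ?ls1)"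
    by blast
  have "{..<?N} \<union> {?N..<?N + r + ?N} = {..<?N + r + ?N}" by auto
  moreover have "drop ?N ?ls1 = []" using len by simp
  moreover have "scalar t / 2 ^ ?N = 1 / (sqrt 2 powi (e + 2 * int ?N))"
    using divide_sqrt2_powi[of e 0 ?N] by (simp add: s)
  ultimately have "t \<sim>\<^sub>T\<^sub>H nf m ?N (1 / (sqrt 2 powi (e + 2 * int ?N))) {..<?N + r + ?N} p'"
    using th_equiv_trans[OF 1 2] by (simp only: nf_def append_Nil2)
  with p' show ?thesis by (intro exI[of _ "e + 2 * int ?N"] exI[of _ "?N + r + ?N"] exI[of _ p']) simp
qed

theorem theorem6p11:
  fixes k n m :: nat and t1 t2 :: sop
  assumes "k \<ge> 1"
    and "t1 \<in> SOP_dyadic (k + 1) n m"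
    and "t2 \<in> SOP_dyadic (k + 1) n m"
  shows "interp t1 = interp t2 \<longleftrightarrow> t1 \<sim>\<^sub>T\<^sub>H t2"
proof
  assume eq: "interp t1 = interp t2"
  let ?K = "k + 1 + 3" and ?N = "m + n"
  obtain q1 L1 p1 where 1: "?N \<le> L1" "dyadic ?K p1" "t1 \<sim>\<^sub>T\<^sub>H nf m ?N (1 / (sqrt 2 powi q1)) {..<L1} p1"
    using dyadic_th_equiv_nf[OF assms(2)] by blast
  obtain q2 L2 p2 where 2: "?N \<le> L2" "dyadic ?K p2" "t2 \<sim>\<^sub>T\<^sub>H nf m ?N (1 / (sqrt 2 powi q2)) {..<L2} p2"
    using dyadic_th_equiv_nf[OF assms(3)] by blast
  \<comment> \<open>Adding a variable by \<open>sqrt2\<close> raises the exponent of sqrt 2 and the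
    number of variables by 1 each and so keeps their difference, whereas Elim raises them by 2 and
    1. Hence the numbers \<open>b1\<close>, \<open>b2\<close> of Elim steps equalize the
    differences, with discrepancy \<open>D\<close>, and \<open>a1\<close>, \<open>a2\<close> then
    equalize the numbers of variables.\<close>
  define D where "D = (q2 - int L2) - (q1 - int L1)"
  define b1 b2 where "b1 = nat D" and "b2 = nat (- D)"
  define E where "E = int (L2 + b2) - int (L1 + b1)"
  define a1 a2 where "a1 = nat E" and "a2 = nat (- E)"
  have L: "L1 + a1 + b1 = L2 + a2 + b2"
    by (simp add: a1_def a2_def E_def)
  have Q: "q1 + int a1 + 2 * int b1 = q2 + int a2 + 2 * int b2"
  proof -
    have "int b1 - int b2 = D" by (simp add: b1_def b2_def)
    moreover have "int L1 + int a1 + int b1 = int L2 + int a2 + int b2"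
      using L by linarith
    ultimately show ?thesis by (simp add: D_def)
  qed
  define s where "s = 1 / (sqrt 2 powi (q1 + int a1 + 2 * int b1))"
  have K: "3 \<le> ?K" by simp
  obtain p1' where p1': "dyadic ?K p1'"
      "nf m ?N (1 / (sqrt 2 powi q1)) {..<L1} p1 \<sim>\<^sub>T\<^sub>H nf m ?N s {..<L1 + a1 + b1} p1'"
    using nf_add_vars[OF 1(1) K 1(2), of m "1 / (sqrt 2 powi q1)" a1 b1] unfolding divide_sqrt2_powi s_def by blast
  obtain p2' where p2': "dyadic ?K p2'"
      "nf m ?N (1 / (sqrt 2 powi q2)) {..<L2} p2 \<sim>\<^sub>T\<^sub>H nf m ?N s {..<L1 + a1 + b1} p2'"
    using nf_add_vars[OF 2(1) K 2(2), of m "1 / (sqrt 2 powi q2)" a2 b2] unfolding divide_sqrt2_powi s_def Q L by blast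
  have t1: "t1 \<sim>\<^sub>T\<^sub>H nf m ?N s {..<L1 + a1 + b1} p1'" by (rule th_equiv_trans[OF 1(3) p1'(2)])
  have t2: "t2 \<sim>\<^sub>T\<^sub>H nf m ?N s {..<L1 + a1 + b1} p2'" by (rule th_equiv_trans[OF 2(3) p2'(2)])
  have "nf m ?N s {..<L1 + a1 + b1} p1' \<sim>\<^sub>T\<^sub>H nf m ?N s {..<L1 + a1 + b1} p2'"
  proof (rule nf_complete)
    show "interp (nf m ?N s {..<L1 + a1 + b1} p1') = interp (nf m ?N s {..<L1 + a1 + b1} p2')"
      using interp_th_equiv[OF t1] interp_th_equiv[OF t2] eq by simp
    show "dyadic (Suc (k + 3)) p1'" "dyadic (Suc (k + 3)) p2'" using p1'(1) p2'(1) by simp_all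
  qed (use 1(1) in \<open>auto simp: s_def\<close>)
  with t1 have "t1 \<sim>\<^sub>T\<^sub>H nf m ?N s {..<L1 + a1 + b1} p2'" by (rule th_equiv_trans)
  then show "t1 \<sim>\<^sub>T\<^sub>H t2" using th_equiv_sym[OF t2] by (rule th_equiv_trans)
qed (rule interp_th_equiv)

end
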